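(* Every Hilbert space has Fourier tile-type $2$. In fact, for a Hilbert space $H$ the following more precise estimate is valid: $$\begin{aligned} \Big(\sum_{\mathbb{T}\in\mathscr{T}}\Big\|\sum_{P\in\mathbb{T}}\langle f,\phi_P\rangle\phi_P\Big\|_{L^2(\mathbb{R};H)}^2\Big)^{1/2} &\le C\Big(\sum_{P\in\mathbb{P}}|\langle f,\phi_P\rangle|^2\Big)^{1/2}\\ &\le C\|f\|_{L^2(\mathbb{R};H)}\Big\{1+\log_+\Big(\frac{\|f\|_{L^\infty(\mathbb{R};H)}}{\|f\|_{L^2(\mathbb{R};H)}}\Big[\sum_{\mathbb{T}\in\mathscr{T}}|I_{\mathbb{T}}|\Big]^{1/2}\Big)\Big\}^{1/2}\\ &\le C\|f\|_{L^2(\mathbb{R};H)}+\frac{C}{\sqrt{1-\alpha}}\Big(\|f\|_{L^\infty(\mathbb{R};H)}\Big[\sum_{\mathbb{T}\in\mathscr{T}}|I_{\mathbb{T}}|\Big]^{1/2}\Big)^{1-\alpha}\|f\|_{L^2(\mathbb{R};H)}^{\alpha} \end{aligned}$$ whenever $f\in L^2(\mathbb{R};H)\cap L^\infty(\mathbb{R};H)$, and $\mathbb{P}=\bigcup_{\mathbb{T}\in\mathscr{T}}\mathbb{T}$, where $\mathscr{T}$ is a finite collection of finite trees with the following property: if $P\in\mathbb{T}\in\mathscr{T}$ and $P'\in\mathbb{T}'\in\mathscr{T}$ satisfy $\omega_P\subseteq\omega_{P'_d}$, then $I_{P'}\cap I_{\mathbb{T}}=\varnothing$. Here $C$ is independent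 of $\alpha\in(0,1)$.
   Context: Tiles. Take dyadic grids $\mathscr{D}=\{t+[n2^kr,(n+1)2^kr):n,k\in\mathbb{Z}\}$ (time) and $\mathscr{D}'=\{t'+[n2^k/r,(n+1)2^k/r):n,k\in\mathbb{Z}\}$ (frequency), where $t,t'\in\mathbb{R}$, $r>0$. A tile is a rectangle $P=I_P\times\omega_P$ with $I_P\in\mathscr{D}$, $\omega_P\in\mathscr{D}'$, $|I_P||\omega_P|=1$. For an interval $J$, $c(J)$ is its center. Put $\omega_{P_u}=\omega_P\cap[c(\omega_P),\infty)$ (upper half) and $\omega_{P_d}=\omega_P\cap(-\infty,c(\omega_P))$ (lower half). Wave packets. Fix a Schwartz function $\varphi$ with $\widehat\varphi\ge0$ supported in $[-1/20,1/20]$ and $\sum_{n\in\mathbb{Z}}\widehat\varphi(\xi+n/20)^2$ equal to a constant. For a tile $P$, $\phi_P(x):=e^{2\pi i c(\omega_{P_d})x}|I_P|^{-1/2}\varphi\big((x-c(I_P))/|I_P|\big)$; $\langle f,\phi_P\rangle=\int f\overline{\phi_P}$. Trees. $P\le P'$ means $I_P\subseteq I_{P'}$ and $\omega_P\supseteq\omega_{P'}$. A tree $\mathbb{T}$ is a collection of tiles for which there is a tile $T$ (a top, not necessarily in $\mathbb{T}$) with $P\le T$ for all $P\in\mathbb{T}$; $I_{\mathbb{T}}$ is the unique minimal time interval $I_T$ among the tops. Standing convention: every collection of tiles considered is such that if $P\ne P'$ belong to it and $\omega_P=\omega_{P'}$, then $I_P=I_{P'}+20n|I_P|$ for some integer $n$.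 Fourier tile-type. A Banach space $X$ has Fourier tile-type $(q,\alpha)$ if there is a constant $C$ such that $$\Big(\sum_{\mathbb{T}\in\mathscr{T}}\Big\|\sum_{P\in\mathbb{T}}\langle f,\phi_P\rangle\phi_P\Big\|_{L^q(\mathbb{R};X)}^q\Big)^{1/q}\le C\|f\|_{L^q(\mathbb{R};X)}+C\Big(\|f\|_{L^\infty(\mathbb{R};X)}\Big[\sum_{\mathbb{T}\in\mathscr{T}}|I_{\mathbb{T}}|\Big]^{1/q}\Big)^{1-\alpha}\|f\|_{L^q(\mathbb{R};X)}^{\alpha}$$ whenever $f\in L^q(\mathbb{R};X)\cap L^\infty(\mathbb{R};X)$ and $\mathscr{T}$ is a finite collection of finite trees with the property stated in the claim. $X$ has Fourier tile-type $q$ if it has Fourier tile-type $(q,\alpha)$ for every $\alpha\in(0,1)$. $\log_+ s=\max(\log s,0)$. The constant $C$ may differ from line to line.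
   Formalization: The trees in the collection are assumed pairwise disjoint (and nonempty); if many trees may share a tile P, that tile is counted repeatedly on the left but once in the sum over the union, and the first inequality fails. *)

theory Defs
  imports "HOL-Analysis.Analysis" "HOL-Probability.Essential_Supremum"
begin

section \<open>Complex Banach and Hilbert spaces\<close>

class complex_banach = banach +
  fixes scaleC :: "complex \<Rightarrow> 'a \<Rightarrow> 'a"  (infixr \<open>*\<^sub>C\<close> 75)
  assumes scaleC_add_right: "c *\<^sub>C (x + y) = c *\<^sub>C x + c *\<^sub>C y"
    and scaleC_add_left: "(c + d) *\<^sub>C x = c *\<^sub>C x + d *\<^sub>C x"
    and scaleC_scaleC: "c *\<^sub>C d *\<^sub>C x = (c * d) *\<^sub>C x"
    and scaleR_eq_scaleC: "a *\<^sub>R x = complex_of_real a *\<^sub>C x"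
    and norm_scaleC: "norm (c *\<^sub>C x) = norm c * norm x"

(* The inner product is linear in its first argument. *)
class complex_hilbert = complex_banach +
  fixes cinner :: "'a \<Rightarrow> 'a \<Rightarrow> complex"
  assumes cinner_commute: "cinner x y = cnj (cinner y x)"
    and cinner_add_left: "cinner (x + y) z = cinner x z + cinner y z"
    and cinner_scaleC_left: "cinner (c *\<^sub>C x) y = c * cinner x y"
    and cinner_self: "cinner x x = complex_of_real ((norm x)\<^sup>2)"

instantiation complex :: complex_hilbert
begin

definition scaleC_complex :: "complex \<Rightarrow> complex \<Rightarrow> complex"
  where "scaleC_complex c x = c * x"

definition cinner_complex :: "complex \<Rightarrow> complex \<Rightarrow> complex"
  where "cinner_complex x y = x * cnj y"

instance
proof
  fix a :: real and c d x y z :: complex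
  show "c *\<^sub>C (x + y) = c *\<^sub>C x + c *\<^sub>C y" "(c + d) *\<^sub>C x = c *\<^sub>C x + d *\<^sub>C x"
    "c *\<^sub>C d *\<^sub>C x = (c * d) *\<^sub>C x"
    by (simp_all add: scaleC_complex_def algebra_simps)
  show "a *\<^sub>R x = complex_of_real a *\<^sub>C x"
    by (simp add: scaleC_complex_def scaleR_conv_of_real)
  show "norm (c *\<^sub>C x) = norm c * norm x"
    by (simp add: scaleC_complex_def norm_mult)
  show "cinner x y = cnj (cinner y x)" "cinner (x + y) z = cinner x z + cinner y z"
    "cinner (c *\<^sub>C x) y = c * cinner x y"
    by (simp_all add: cinner_complex_def scaleC_complex_def algebra_simps)
  show "cinner x x = complex_of_real ((norm x)\<^sup>2)"
    by (simp add: cinner_complex_def flip: complex_norm_square)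
qed

end


section \<open>Lebesgue spaces of vector-valued functions\<close>

(* Measurability in the sense of Bochner.  The library's Bochner theory requires a
   second-countable target, which would exclude non-separable spaces. *)
definition strongly_measurable :: "(real \<Rightarrow> 'a::real_normed_vector) \<Rightarrow> bool"
  where "strongly_measurable f \<longleftrightarrow>
    (\<exists>s :: nat \<Rightarrow> real \<Rightarrow> 'a. (\<forall>i. simple_function lebesgue (s i)) \<and>
       (AE x in lebesgue. (\<lambda>i. s i x) \<longlonglongrightarrow> f x))"

definition Lq_space :: "real \<Rightarrow> (real \<Rightarrow> 'a::real_normed_vector) set"
  where "Lq_space q =
    {f. strongly_measurable f \<and> integrable lebesgue (\<lambda>x. norm (f x) powr q)}"

definition Lq_norm :: "real \<Rightarrow> (real \<Rightarrow> 'a::real_normed_vector) \<Rightarrow> real"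
  where "Lq_norm q f = (LINT x|lebesgue. norm (f x) powr q) powr (1 / q)"

definition Linf_space :: "(real \<Rightarrow> 'a::real_normed_vector) set"
  where "Linf_space =
    {f. strongly_measurable f \<and> esssup lebesgue (\<lambda>x. ereal (norm (f x))) < \<infinity>}"

definition Linf_norm :: "(real \<Rightarrow> 'a::real_normed_vector) \<Rightarrow> real"
  where "Linf_norm f = real_of_ereal (esssup lebesgue (\<lambda>x. ereal (norm (f x))))"


section \<open>Tiles and trees\<close>

(* A tile is represented by the pair of its time and frequency intervals. *)
type_synonym tile = "real set \<times> real set"

abbreviation time_interval :: "tile \<Rightarrow> real set"
  where "time_interval P \<equiv> fst P"

abbreviation freq_interval :: "tile \<Rightarrow> real set"
  where "freq_interval P \<equiv> snd P"

abbreviation len :: "real set \<Rightarrow> real"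
  where "len J \<equiv> measure lborel J"

definition center :: "real set \<Rightarrow> real"
  where "center J = (Inf J + Sup J) / 2"

definition lower_half :: "real set \<Rightarrow> real set"
  where "lower_half J = J \<inter> {..<center J}"

definition dyadic_grid :: "real \<Rightarrow> real \<Rightarrow> real set set"
  where "dyadic_grid t s =
    {{t + of_int n * 2 powi k * s ..< t + (of_int n + 1) * 2 powi k * s} | (n::int) (k::int). True}"

definition tiles :: "real \<Rightarrow> real \<Rightarrow> real \<Rightarrow> tile set"
  where "tiles t t' r =
    {P. time_interval P \<in> dyadic_grid t r \<and> freq_interval P \<in> dyadic_grid t' (1 / r) \<and>
        len (time_interval P) * len (freq_interval P) = 1}"

definition tile_le :: "tile \<Rightarrow> tile \<Rightarrow> bool"
  where "tile_le P P' \<longleftrightarrow>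
    time_interval P \<subseteq> time_interval P' \<and> freq_interval P' \<subseteq> freq_interval P"

definition tops :: "real \<Rightarrow> real \<Rightarrow> real \<Rightarrow> tile set \<Rightarrow> tile set"
  where "tops t t' r \<T> = {T \<in> tiles t t' r. \<forall>P\<in>\<T>. tile_le P T}"

(* The empty collection is excluded: it has no minimal top interval. *)
definition is_tree :: "real \<Rightarrow> real \<Rightarrow> real \<Rightarrow> tile set \<Rightarrow> bool"
  where "is_tree t t' r \<T> \<longleftrightarrow> \<T> \<noteq> {} \<and> \<T> \<subseteq> tiles t t' r \<and> tops t t' r \<T> \<noteq> {}"

definition tree_interval :: "real \<Rightarrow> real \<Rightarrow> real \<Rightarrow> tile set \<Rightarrow> real set"
  where "tree_interval t t' r \<T> =
    (THE I. I \<in> time_interval ` tops t t' r \<T> \<and>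
            (\<forall>J \<in> time_interval ` tops t t' r \<T>. J \<subseteq> I \<longrightarrow> J = I))"

definition spaced :: "tile set \<Rightarrow> bool"
  where "spaced \<P> \<longleftrightarrow>
    (\<forall>P\<in>\<P>. \<forall>P'\<in>\<P>. P \<noteq> P' \<and> freq_interval P = freq_interval P' \<longrightarrow>
       (\<exists>n::int. time_interval P =
          (\<lambda>x. x + 20 * of_int n * len (time_interval P)) ` time_interval P'))"

(* The trees are pairwise disjoint as sets of tiles, so that they partition their union.
   This is implicit in passing from the sum over trees to the sum over all tiles: by
   orthogonality of the wave packets in one tree, a tile shared by N trees contributes
   N times to the former sum but once to the latter, so no uniform bound would hold. *)
definition admissible_trees :: "real \<Rightarrow> real \<Rightarrow> real \<Rightarrow> tile set set \<Rightarrow> bool"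
  where "admissible_trees t t' r \<F> \<longleftrightarrow>
    finite \<F> \<and> (\<forall>\<T>\<in>\<F>. finite \<T> \<and> is_tree t t' r \<T>) \<and> disjoint \<F> \<and> spaced (\<Union>\<F>) \<and>
    (\<forall>\<T>\<in>\<F>. \<forall>P\<in>\<T>. \<forall>\<T>'\<in>\<F>. \<forall>P'\<in>\<T>'.
       freq_interval P \<subseteq> lower_half (freq_interval P') \<longrightarrow>
       time_interval P' \<inter> tree_interval t t' r \<T> = {})"


section \<open>Wave packets\<close>

definition schwartz :: "(real \<Rightarrow> complex) \<Rightarrow> bool"
  where "schwartz \<phi> \<longleftrightarrow>
    (\<exists>D :: nat \<Rightarrow> real \<Rightarrow> complex. D 0 = \<phi> \<and>
       (\<forall>n x. (D n has_vector_derivative D (Suc n) x) (at x)) \<and>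
       (\<forall>n k. bounded (range (\<lambda>x. x ^ k *\<^sub>R D n x))))"

definition fourier :: "(real \<Rightarrow> complex) \<Rightarrow> real \<Rightarrow> complex"
  where "fourier \<phi> \<xi> = (LINT x|lborel. \<phi> x * cis (- 2 * pi * x * \<xi>))"

definition wave_packet_profile :: "(real \<Rightarrow> complex) \<Rightarrow> bool"
  where "wave_packet_profile \<phi> \<longleftrightarrow> schwartz \<phi> \<and>
    (\<forall>\<xi>. fourier \<phi> \<xi> \<in> nonneg_Reals) \<and>
    (\<forall>\<xi>. fourier \<phi> \<xi> \<noteq> 0 \<longrightarrow> \<xi> \<in> {-1/20..1/20}) \<and>
    (\<exists>c. \<forall>\<xi>. ((\<lambda>n::int. (fourier \<phi> (\<xi> + of_int n / 20))\<^sup>2) has_sum c) UNIV)"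

definition wave_packet :: "(real \<Rightarrow> complex) \<Rightarrow> tile \<Rightarrow> real \<Rightarrow> complex"
  where "wave_packet \<phi> P x =
    cis (2 * pi * center (lower_half (freq_interval P)) * x) *
    complex_of_real (len (time_interval P) powr (- 1 / 2)) *
    \<phi> ((x - center (time_interval P)) / len (time_interval P))"

(* The vector-valued integral is the library's gauge integral, which is available in every
   normed space and agrees with the Bochner integral on Bochner integrable functions. *)
definition coefficient :: "(real \<Rightarrow> complex) \<Rightarrow> (real \<Rightarrow> 'a::complex_banach) \<Rightarrow> tile \<Rightarrow> 'a"
  where "coefficient \<phi> f P = integral UNIV (\<lambda>x. cnj (wave_packet \<phi> P x) *\<^sub>C f x)"

definition tree_sum ::
    "(real \<Rightarrow> complex) \<Rightarrow> (real \<Rightarrow> 'a::complex_banach) \<Rightarrow> tile set \<Rightarrow> real \<Rightarrow> 'a"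
  where "tree_sum \<phi> f \<T> x = (\<Sum>P\<in>\<T>. wave_packet \<phi> P x *\<^sub>C coefficient \<phi> f P)"


section \<open>Fourier tile-type\<close>

(* The constant is uniform over the dyadic grids; by translation, modulation and dilation
   invariance this is the same as a constant for one fixed choice of grids. *)
definition fourier_tile_type_with ::
    "'a::complex_banach itself \<Rightarrow> (real \<Rightarrow> complex) \<Rightarrow> real \<Rightarrow> real \<Rightarrow> bool"
  where "fourier_tile_type_with X \<phi> q \<alpha> \<longleftrightarrow>
    (\<exists>C. \<forall>t t' r. \<forall>f :: real \<Rightarrow> 'a. \<forall>\<F>.
       r > 0 \<longrightarrow> f \<in> Lq_space q \<inter> Linf_space \<longrightarrow> admissible_trees t t' r \<F> \<longrightarrow>
       (\<Sum>\<T>\<in>\<F>. (Lq_norm q (tree_sum \<phi> f \<T>)) powr q) powr (1 / q)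
       \<le> C * Lq_norm q f +
         C * (Linf_norm f * (\<Sum>\<T>\<in>\<F>. len (tree_interval t t' r \<T>)) powr (1 / q)) powr (1 - \<alpha>)
           * Lq_norm q f powr \<alpha>)"

definition fourier_tile_type ::
    "'a::complex_banach itself \<Rightarrow> (real \<Rightarrow> complex) \<Rightarrow> real \<Rightarrow> bool"
  where "fourier_tile_type X \<phi> q \<longleftrightarrow> (\<forall>\<alpha>\<in>{0<..<1}. fourier_tile_type_with X \<phi> q \<alpha>)"

(* The value at 0 differs from the usual log 0 = -infinity, but the maximum does not. *)
definition log_plus :: "real \<Rightarrow> real"
  where "log_plus s = max (ln s) 0"

end

theory Submission
  imports Defs "HOL-Probability.Characteristic_Functions" "HOL-Probability.Sinc_Integral"
begin

text \<open>
  Wave packets with disjoint frequency supports are orthogonal, and so are those with a common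
  frequency interval, because the periodization of the squared Fourier transform of \<open>\<phi>\<close> is constant. Hence packets
  of different tiles interact only if one frequency interval lies in the lower half of the other,
  which never happens inside a tree; this gives the first inequality, by Pythagoras.

  For the second one, write \<open>S(Q)\<close> for the sum of \<open>|\<langle>f, \<phi>\<^sub>P\<rangle>|\<^sup>2\<close> over a set \<open>Q\<close> of tiles. By duality
  \<open>S(Q)\<^sup>2 \<le> \<parallel>f\<parallel>\<^sup>2 \<parallel>\<Sum>\<langle>f, \<phi>\<^sub>P\<rangle>\<phi>\<^sub>P\<parallel>\<^sup>2\<close>. In the off-diagonal part, the tiles whose lower frequency half
  contains \<open>\<omega>\<^sub>P\<close> have pairwise disjoint time intervals outside the top of the tree of \<open>P\<close>. If the
  coefficients on \<open>Q\<close> are at most \<open>A|I\<^sub>P|\<^sup>1\<^sup>/\<^sup>2\<close>, the decay of \<open>\<phi>\<close> then bounds this part by a multiple of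
  the sum of \<open>A|\<langle>f, \<phi>\<^sub>P\<rangle>||I\<^sub>P|\<^sup>1\<^sup>/\<^sup>2 w(P)\<close>, where the weight \<open>w(P) \<le> 1\<close> decays away from the boundary of
  the top. This yields \<open>S(Q) \<le> C\<parallel>f\<parallel>\<^sup>2\<close> in two cases: if the coefficients are comparable to \<open>A|I\<^sub>P|\<^sup>1\<^sup>/\<^sup>2\<close>,
  and if \<open>A(\<Sum>|I\<^sub>T|)\<^sup>1\<^sup>/\<^sup>2 \<le> \<parallel>f\<parallel>\<close>. Starting from \<open>A \<sim> \<parallel>f\<parallel>\<^sub>\<infinity>\<close> and halving \<open>A\<close>, the second case is reached
  after logarithmically many steps, each of which splits off a level set of the first kind.
\<close>

section \<open>Fourier inversion\<close>

lemma measurable_cis [measurable]: "cis \<in> borel_measurable borel"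
  by (intro borel_measurable_continuous_onI continuous_intros)

text \<open>The product \<open>f x * g y\<close> is integrable on the plane, and a kernel of modulus
  at most one keeps it so. The kernels meant are the exponentials of the Fourier transform.\<close>

lemma Fubini_bounded_kernel:
  fixes f g :: "real \<Rightarrow> complex" and k :: "real \<times> real \<Rightarrow> complex"
  assumes f: "integrable lborel f" and g: "integrable lborel g"
    and k [measurable]: "k \<in> borel_measurable borel"
    and k1: "\<And>p. norm (k p) \<le> 1"
  shows "(LINT x|lborel. LINT y|lborel. f x * g y * k (x, y)) =
         (LINT y|lborel. LINT x|lborel. f x * g y * k (x, y))"
proof -
  have [measurable]: "f \<in> borel_measurable borel" "g \<in> borel_measurable borel"
    using f g by (auto dest: borel_measurable_integrable)
  have kp [measurable]: "k \<in> borel_measurable (lborel \<Otimes>\<^sub>M lborel)"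
    by (simp add: lborel_prod)
  have fg: "integrable (lborel \<Otimes>\<^sub>M lborel) (\<lambda>(x, y). f x * g y)"
    by (rule lborel_pair.Fubini_integrable) (use f g in \<open>auto simp: norm_mult\<close>)
  have "integrable (lborel \<Otimes>\<^sub>M lborel) (\<lambda>(x, y). f x * g y * k (x, y))"
    by (rule Bochner_Integration.integrable_bound[OF fg])
      (auto simp: norm_mult mult_left_le k1)
  from lborel_pair.Fubini_integral[OF this] show ?thesis
    by simp
qed

lemma char_std_normal_LINT:
  "(LINT z|lborel. of_real (std_normal_density z) * cis (t * z)) = complex_of_real (exp (- t\<^sup>2 / 2))"
proof -
  have "complex_of_real (exp (- t\<^sup>2 / 2)) = (CLINT z|std_normal_distribution. cis (t * z))"
    unfolding char_std_normal_distribution[THEN fun_cong, symmetric] char_def cis_conv_exp by simp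
  also have "\<dots> = (CLINT z|lborel. std_normal_density z *\<^sub>R cis (t * z))"
    by (subst integral_density) auto
  finally show ?thesis
    by (simp add: scaleR_conv_of_real)
qed

lemma integrable_std_normal_density: "integrable lborel std_normal_density"
  using integrable_std_normal_moment[of 0] by simp

text \<open>Gaussian regularization: averaging \<open>f\<close> around \<open>x\<close> at scale
  \<open>d m\<close> equals, by Fubini, the inversion integral damped by a Gaussian. As
  \<open>d m\<close> tends to 0, dominated convergence applies on both sides, through continuity and
  the bound \<open>B\<close> on the left and through \<open>intF\<close> on the right.\<close>

lemma fourier_inversion:
  fixes f :: "real \<Rightarrow> complex"
  assumes int: "integrable lborel f" and cont: "continuous_on UNIV f"
    and bdd: "\<And>x. norm (f x) \<le> B" and intF: "integrable lborel (fourier f)"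
  shows "f x = (LINT \<xi>|lborel. fourier f \<xi> * cis (2 * pi * x * \<xi>))"
proof -
  define n where "n z = complex_of_real (std_normal_density z)" for z
  have [measurable]: "n \<in> borel_measurable borel"
    unfolding n_def by measurable
  have intn: "integrable lborel n"
    unfolding n_def using integrable_std_normal_density by simp
  have [measurable]: "f \<in> borel_measurable borel" "fourier f \<in> borel_measurable borel"
    using int intF by (auto dest: borel_measurable_integrable)
  define d where "d m = 1 / real (Suc m)" for m
  have d0: "d m > 0" for m
    by (simp add: d_def)
  have dlim: "d \<longlonglongrightarrow> 0"
    unfolding d_def using LIMSEQ_inverse_real_of_nat by (simp add: inverse_eq_divide)
  have n1: "(LINT z|lborel. n z) = 1"
    using char_std_normal_LINT[of 0] by (simp add: n_def)
  \<comment> \<open>The Gaussian averages of \<open>f\<close> at \<open>x\<close> are the inversion integral with a Gaussian damping factor.\<close>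
  have eq: "(LINT z|lborel. f (x + d m * z) * n z) =
        (LINT \<xi>|lborel. fourier f \<xi> * cis (2 * pi * x * \<xi>) * of_real (exp (- (2 * pi * d m * \<xi>)\<^sup>2 / 2)))"
    (is "?L = ?R") for m
  proof -
    have intd: "integrable lborel (\<lambda>z. f (x + d m * z))"
      using int d0[of m] by (simp add: lborel_integrable_real_affine)
    \<comment> \<open>The Gaussian is, up to a factor, its own Fourier transform; writing it as an
      integral of exponentials lets these be paired with \<open>f\<close>.\<close>
    have nz: "n z = (LINT w|lborel. of_real (1 / sqrt (2 * pi)) * n w * cis (- (z * w)))" for z
      using char_std_normal_LINT[of "-z"]
      by (simp add: n_def mult.assoc std_normal_density_def[of z] integral_mult_right_zero)
    have "?L = (LINT z|lborel. LINT w|lborel. f (x + d m * z) * n w * (of_real (1 / sqrt (2 * pi)) * cis (- (z * w))))"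
      by (subst nz, subst integral_mult_right_zero[symmetric]) (simp add: mult_ac)
    also have "\<dots> = of_real (1 / sqrt (2 * pi)) * (LINT z|lborel. LINT w|lborel. f (x + d m * z) * n w * cis (- (z * w)))"
      by (simp add: integral_mult_right_zero[symmetric] mult_ac del: integral_mult_right_zero)
    also have "\<dots> = of_real (1 / sqrt (2 * pi)) * (LINT w|lborel. LINT z|lborel. f (x + d m * z) * n w * cis (- (z * w)))"
      using Fubini_bounded_kernel[OF intd intn, of "\<lambda>p. cis (- (fst p * snd p))"]
      by (simp add: borel_measurable_continuous_onI continuous_intros)
    finally have L1: "?L = of_real (1 / sqrt (2 * pi)) * (LINT w|lborel. LINT z|lborel. f (x + d m * z) * n w * cis (- (z * w)))" .
    \<comment> \<open>The substitution \<open>x + d m * z\<close> turns the inner integral into a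
      value of \<open>fourier f\<close> at a rescaled frequency, times a phase caused by the shift
      \<open>x\<close>.\<close>
    have inner: "(LINT z|lborel. f (x + d m * z) * n w * cis (- (z * w))) =
        n w * (cis (x * w / d m) * fourier f (w / (2 * pi * d m)) / d m)" for w
    proof -
      have "fourier f (w / (2 * pi * d m)) =
        \<bar>d m\<bar> *\<^sub>R (LINT z|lborel. f (x + d m * z) * cis (- 2 * pi * (x + d m * z) * (w / (2 * pi * d m))))"
        unfolding fourier_def by (rule lborel_integral_real_affine) (use d0[of m] in auto)
      also have "(\<lambda>z. f (x + d m * z) * cis (- 2 * pi * (x + d m * z) * (w / (2 * pi * d m)))) =
         (\<lambda>z. cis (- (x * w / d m)) * (f (x + d m * z) * cis (- (z * w))))"
      proof
        fix z
        have *: "- 2 * pi * (x + d m * z) * (w / (2 * pi * d m)) = - (x * w / d m) + - (z * w)"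
          using d0[of m] by (simp add: field_simps)
        show "f (x + d m * z) * cis (- 2 * pi * (x + d m * z) * (w / (2 * pi * d m))) =
            cis (- (x * w / d m)) * (f (x + d m * z) * cis (- (z * w)))"
          unfolding * cis_mult[symmetric] by (simp add: mult.left_commute)
      qed
      also have "(LINT z|lborel. \<dots> z) = cis (- (x * w / d m)) * (LINT z|lborel. f (x + d m * z) * cis (- (z * w)))"
        by simp
      finally have "cis (x * w / d m) * fourier f (w / (2 * pi * d m)) / d m =
         (cis (x * w / d m) * cis (- (x * w / d m))) * (LINT z|lborel. f (x + d m * z) * cis (- (z * w)))"
        using d0[of m] by (simp add: scaleR_conv_of_real)
      also have "\<dots> = (LINT z|lborel. f (x + d m * z) * cis (- (z * w)))"
        by (simp only: cis_mult) simp
      also have "n w * \<dots> = (LINT z|lborel. n w * (f (x + d m * z) * cis (- (z * w))))"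
        by simp
      finally show ?thesis
        by (simp add: mult_ac)
    qed
    have "of_real (1 / sqrt (2 * pi)) * (LINT w|lborel. n w * (cis (x * w / d m) * fourier f (w / (2 * pi * d m)) / d m))
       = (LINT w|lborel. (1 / (2 * pi * d m)) *\<^sub>R (of_real (exp (- w\<^sup>2 / 2)) * cis (x * w / d m) * fourier f (w / (2 * pi * d m))))"
      (is "?A = ?B")
    proof -
      have "?A = (LINT w|lborel. of_real (1 / sqrt (2 * pi)) * (n w * (cis (x * w / d m) * fourier f (w / (2 * pi * d m)) / d m)))"
        by simp
      also have "\<dots> = ?B"
      proof (rule Bochner_Integration.integral_cong)
        fix w
        have "of_real (1 / sqrt (2 * pi)) * (n w * (c * F / of_real (d m))) =
           (1 / (2 * pi * d m)) *\<^sub>R (of_real (exp (- w\<^sup>2 / 2)) * c * F)" for c F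
        proof -
          have "of_real (1 / sqrt (2 * pi)) * (n w * (c * F / of_real (d m))) =
            of_real (1 / sqrt (2 * pi) * std_normal_density w / d m) * (c * F)"
            by (simp add: n_def)
          also have "1 / sqrt (2 * pi) * std_normal_density w / d m = 1 / (2 * pi * d m) * exp (- w\<^sup>2 / 2)"
            by (simp add: std_normal_density_def)
          finally show ?thesis
            by (simp add: scaleR_conv_of_real mult.assoc)
        qed
        then show "complex_of_real (1 / sqrt (2 * pi)) * (n w * (cis (x * w / d m) * fourier f (w / (2 * pi * d m)) / d m)) =
           (1 / (2 * pi * d m)) *\<^sub>R (of_real (exp (- w\<^sup>2 / 2)) * cis (x * w / d m) * fourier f (w / (2 * pi * d m)))" .
      qed simp
      finally show ?thesis .
    qed
    \<comment> \<open>The frequency is spelled as an affine map of \<open>w\<close>, so that the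
      next step is the change of variables back to \<xi>.\<close>
    also have "\<dots> = \<bar>1 / (2 * pi * d m)\<bar> *\<^sub>R (LINT w|lborel. fourier f (0 + 1 / (2 * pi * d m) * w) *
          cis (2 * pi * x * (0 + 1 / (2 * pi * d m) * w)) * of_real (exp (- (2 * pi * d m * (0 + 1 / (2 * pi * d m) * w))\<^sup>2 / 2)))"
      using d0[of m] by (simp add: field_simps)
    also have "\<dots> = ?R"
      by (rule lborel_integral_real_affine[symmetric]) (use d0[of m] in auto)
    finally show ?thesis
      unfolding L1 inner .
  qed
  have L: "(\<lambda>m. LINT z|lborel. f (x + d m * z) * n z) \<longlonglongrightarrow> (LINT z|lborel. f x * n z)"
  proof (rule integral_dominated_convergence[where w="\<lambda>z. B * norm (n z)"])
    show "AE z in lborel. (\<lambda>m. f (x + d m * z) * n z) \<longlonglongrightarrow> f x * n z"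
    proof (intro AE_I2 tendsto_mult tendsto_const)
      fix z
      have "(\<lambda>m. x + d m * z) \<longlonglongrightarrow> x + 0 * z"
        by (intro tendsto_intros dlim)
      then show "(\<lambda>m. f (x + d m * z)) \<longlonglongrightarrow> f x"
        using cont by (auto simp: continuous_on_eq_continuous_at isCont_def intro: isCont_tendsto_compose)
    qed
    show "AE z in lborel. norm (f (x + d m * z) * n z) \<le> B * norm (n z)" for m
      by (intro AE_I2) (simp add: norm_mult bdd mult_right_mono)
  qed (use intn in auto)
  have R: "(\<lambda>m. LINT \<xi>|lborel. fourier f \<xi> * cis (2 * pi * x * \<xi>) * of_real (exp (- (2 * pi * d m * \<xi>)\<^sup>2 / 2)))
     \<longlonglongrightarrow> (LINT \<xi>|lborel. fourier f \<xi> * cis (2 * pi * x * \<xi>))"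
  proof (rule integral_dominated_convergence[where w="\<lambda>\<xi>. norm (fourier f \<xi>)"])
    show "AE \<xi> in lborel. (\<lambda>m. fourier f \<xi> * cis (2 * pi * x * \<xi>) * complex_of_real (exp (- (2 * pi * d m * \<xi>)\<^sup>2 / 2)))
        \<longlonglongrightarrow> fourier f \<xi> * cis (2 * pi * x * \<xi>)"
    proof (intro AE_I2)
      fix \<xi>
      have "(\<lambda>m. fourier f \<xi> * cis (2 * pi * x * \<xi>) * complex_of_real (exp (- (2 * pi * d m * \<xi>)\<^sup>2 / 2)))
        \<longlonglongrightarrow> fourier f \<xi> * cis (2 * pi * x * \<xi>) * complex_of_real (exp (- (2 * pi * 0 * \<xi>)\<^sup>2 / 2))"
        by (intro tendsto_intros dlim) auto
      then show "(\<lambda>m. fourier f \<xi> * cis (2 * pi * x * \<xi>) * complex_of_real (exp (- (2 * pi * d m * \<xi>)\<^sup>2 / 2)))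
        \<longlonglongrightarrow> fourier f \<xi> * cis (2 * pi * x * \<xi>)" by simp
    qed
    show "AE \<xi> in lborel. norm (fourier f \<xi> * cis (2 * pi * x * \<xi>) * complex_of_real (exp (- (2 * pi * d m * \<xi>)\<^sup>2 / 2))) \<le> norm (fourier f \<xi>)" for m
      by (auto simp: norm_mult intro!: mult_left_le)
  qed (use intF in auto)
  from LIMSEQ_unique[OF L[unfolded eq] R] show ?thesis
    by (simp add: n1)
qed

text \<open>Inverting \<open>f\<close> alone and exchanging the integrals leaves the conjugate of
  \<open>fourier g\<close> as the inner integral.\<close>

lemma fourier_parseval:
  fixes f g :: "real \<Rightarrow> complex"
  assumes int: "integrable lborel f" and cont: "continuous_on UNIV f"
    and bdd: "\<And>x. norm (f x) \<le> B" and intF: "integrable lborel (fourier f)"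
    and g: "integrable lborel g"
  shows "(LINT x|lborel. f x * cnj (g x)) = (LINT \<xi>|lborel. fourier f \<xi> * cnj (fourier g \<xi>))"
proof -
  have [measurable]: "g \<in> borel_measurable borel" "fourier f \<in> borel_measurable borel"
    using g intF by (auto dest: borel_measurable_integrable)
  have g': "integrable lborel (\<lambda>x. cnj (g x))"
    using g by simp
  have "(LINT x|lborel. f x * cnj (g x)) =
    (LINT x|lborel. cnj (g x) * (LINT \<xi>|lborel. fourier f \<xi> * cis (2 * pi * x * \<xi>)))"
    by (subst fourier_inversion[OF int cont bdd intF]) (simp add: mult_ac)
  also have "\<dots> = (LINT x|lborel. LINT \<xi>|lborel. cnj (g x) * fourier f \<xi> * cis (2 * pi * x * \<xi>))"
    by (simp add: mult.assoc)
  also have "\<dots> = (LINT \<xi>|lborel. LINT x|lborel. cnj (g x) * fourier f \<xi> * cis (2 * pi * x * \<xi>))"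
    using Fubini_bounded_kernel[OF g' intF, of "\<lambda>p. cis (2 * pi * fst p * snd p)"]
    by (simp add: borel_measurable_continuous_onI continuous_intros)
  also have "\<dots> = (LINT \<xi>|lborel. fourier f \<xi> * (LINT x|lborel. cnj (g x) * cis (2 * pi * x * \<xi>)))"
    by (simp add: mult_ac integral_mult_right_zero[symmetric] del: integral_mult_right_zero)
  also have "\<dots> = (LINT \<xi>|lborel. fourier f \<xi> * cnj (fourier g \<xi>))"
    unfolding fourier_def[of g] Bochner_Integration.integral_cnj[symmetric] by (simp only: complex_cnj_mult cis_cnj) simp
  finally show ?thesis .
qed

section \<open>Hilbert-space-valued wave packet expansions\<close>

context complex_hilbert
begin

lemma cinner_add_right: "cinner x (y + z) = cinner x y + cinner x z"
  by (metis cinner_add_left cinner_commute complex_cnj_add)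

lemma cinner_scaleC_right: "cinner x (c *\<^sub>C y) = cnj c * cinner x y"
  by (metis cinner_commute cinner_scaleC_left complex_cnj_mult)

lemma cinner_zero_left [simp]: "cinner 0 y = 0"
  using cinner_add_left[of 0 0 y] by simp

lemma cinner_zero_right [simp]: "cinner y 0 = 0"
  using cinner_add_right[of y 0 0] by simp

lemma cinner_scaleR_left: "cinner (r *\<^sub>R x) y = of_real r * cinner x y"
  by (simp add: scaleR_eq_scaleC cinner_scaleC_left)

lemma cinner_sum_left: "cinner (\<Sum>i\<in>I. f i) y = (\<Sum>i\<in>I. cinner (f i) y)"
  by (induction I rule: infinite_finite_induct) (auto simp: cinner_add_left)

lemma cinner_sum_right: "cinner y (\<Sum>i\<in>I. f i) = (\<Sum>i\<in>I. cinner y (f i))"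
  by (induction I rule: infinite_finite_induct) (auto simp: cinner_add_right)

lemma cinner_Cauchy_Schwarz: "cmod (cinner x y) \<le> norm x * norm y"
proof (cases "y = 0")
  case False
  then have y: "norm y > 0" by simp
  \<comment> \<open>This multiple makes \<open>x + c *\<^sub>C y\<close> the component of
    \<open>x\<close> orthogonal to \<open>y\<close>; its squared norm is nonnegative.\<close>
  define c where "c = - cinner x y / of_real ((norm y)\<^sup>2)"
  have "of_real ((norm (x + c *\<^sub>C y))\<^sup>2) =
      cinner x x + cnj c * cinner x y + c * cnj (cinner x y) + c * cnj c * cinner y y"
    unfolding cinner_self[symmetric]
    by (simp add: cinner_add_left cinner_add_right cinner_scaleC_left cinner_scaleC_right
          cinner_commute[of y x] algebra_simps)
  also have "\<dots> = of_real ((norm x)\<^sup>2) - cinner x y * cnj (cinner x y) / of_real ((norm y)\<^sup>2)"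
    using y by (simp add: c_def cinner_self field_simps power2_eq_square)
  also have "\<dots> = of_real ((norm x)\<^sup>2 - (cmod (cinner x y))\<^sup>2 / (norm y)\<^sup>2)"
    by (simp add: complex_norm_square[symmetric])
  finally have "(norm (x + c *\<^sub>C y))\<^sup>2 = (norm x)\<^sup>2 - (cmod (cinner x y))\<^sup>2 / (norm y)\<^sup>2"
    using of_real_eq_iff by blast
  then have "(cmod (cinner x y))\<^sup>2 / (norm y)\<^sup>2 \<le> (norm x)\<^sup>2"
    by (metis diff_ge_0_iff_ge zero_le_power2)
  then have "(cmod (cinner x y))\<^sup>2 \<le> (norm x * norm y)\<^sup>2"
    using y by (simp add: field_simps)
  then show ?thesis
    by (meson mult_nonneg_nonneg norm_ge_zero power2_le_imp_le)
qed simp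

lemma norm_sum_scaleC_sq:
  "(norm (\<Sum>i\<in>I. c i *\<^sub>C a i))\<^sup>2 =
     Re (\<Sum>i\<in>I. \<Sum>j\<in>I. c i * cnj (c j) * cinner (a i) (a j))"
proof -
  have "complex_of_real ((norm (\<Sum>i\<in>I. c i *\<^sub>C a i))\<^sup>2) =
     (\<Sum>i\<in>I. \<Sum>j\<in>I. c i * cnj (c j) * cinner (a i) (a j))"
    unfolding cinner_self[symmetric] cinner_sum_left cinner_sum_right[of "c i *\<^sub>C a i" for i]
    by (simp add: cinner_scaleC_left cinner_scaleC_right mult_ac)
  then show ?thesis
    by (metis Re_complex_of_real)
qed

end

text \<open>Allows the inner product with a fixed vector to be taken inside the gauge integral that
  defines a coefficient.\<close>

lemma bounded_linear_cinner_left: "bounded_linear (\<lambda>x::'a::complex_hilbert. cinner x y)"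
  by (rule bounded_linear_intro[of _ "norm y"])
    (auto simp: cinner_add_left cinner_scaleR_left cinner_Cauchy_Schwarz scaleR_conv_of_real)

lemma Cauchy_Schwarz_lebesgue_integral:
  fixes u v :: "'a \<Rightarrow> real"
  assumes u [measurable]: "u \<in> borel_measurable M" and v [measurable]: "v \<in> borel_measurable M"
    and u2: "integrable M (\<lambda>x. (u x)\<^sup>2)" and v2: "integrable M (\<lambda>x. (v x)\<^sup>2)"
  shows "integrable M (\<lambda>x. u x * v x)"
    and "(LINT x|M. u x * v x) \<le> sqrt (LINT x|M. (u x)\<^sup>2) * sqrt (LINT x|M. (v x)\<^sup>2)"
proof -
  show uv: "integrable M (\<lambda>x. u x * v x)"
  proof (rule Bochner_Integration.integrable_bound[OF Bochner_Integration.integrable_add[OF u2 v2]])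
    show "AE x in M. norm (u x * v x) \<le> norm ((u x)\<^sup>2 + (v x)\<^sup>2)"
    proof (rule AE_I2)
      fix x
      show "norm (u x * v x) \<le> norm ((u x)\<^sup>2 + (v x)\<^sup>2)"
        using sum_squares_bound[of "\<bar>u x\<bar>" "\<bar>v x\<bar>"] mult_nonneg_nonneg[of "\<bar>u x\<bar>" "\<bar>v x\<bar>"]
        by (simp add: abs_mult del: mult_nonneg_nonneg)
    qed
  qed measurable
  define A B c where "A = (LINT x|M. (u x)\<^sup>2)" and "B = (LINT x|M. (v x)\<^sup>2)" and "c = (LINT x|M. u x * v x)"
  have A: "A \<ge> 0" and B: "B \<ge> 0"
    unfolding A_def B_def by simp_all
  have "c\<^sup>2 \<le> A * B"
  proof (cases "B = 0")
    case True
    then have "AE x in M. (v x)\<^sup>2 = 0"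
      using v2 integral_nonneg_eq_0_iff_AE[of M "\<lambda>x. (v x)\<^sup>2"] unfolding B_def by simp
    then have "c = (LINT x|M. 0)"
      unfolding c_def by (intro integral_cong_AE) auto
    then show ?thesis using True by simp
  next
    case False
    then have "B > 0" using B by simp
    \<comment> \<open>Up to the factor \<open>B\<close> this subtracts from \<open>u\<close> its
      projection \<open>c / B\<close> times \<open>v\<close>; the integral of the expanded square is
      \<open>B\<close> times the desired difference.\<close>
    have "0 \<le> (LINT x|M. (B * u x - c * v x)\<^sup>2)"
      by simp
    also have "\<dots> = (LINT x|M. B\<^sup>2 * (u x)\<^sup>2 - 2 * B * c * (u x * v x) + c\<^sup>2 * (v x)\<^sup>2)"
      by (intro Bochner_Integration.integral_cong) (auto simp: power2_eq_square algebra_simps)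
    also have "\<dots> = B\<^sup>2 * A - 2 * B * c * c + c\<^sup>2 * B"
      unfolding A_def B_def c_def using u2 v2 uv by simp
    also have "\<dots> = B * (A * B - c\<^sup>2)"
      by (simp add: power2_eq_square algebra_simps)
    finally show ?thesis
      using \<open>B > 0\<close> by (simp add: zero_le_mult_iff)
  qed
  then have "\<bar>c\<bar> \<le> sqrt (A * B)"
    using real_le_rsqrt[of "\<bar>c\<bar>" "A * B"] by simp
  then show "(LINT x|M. u x * v x) \<le> sqrt (LINT x|M. (u x)\<^sup>2) * sqrt (LINT x|M. (v x)\<^sup>2)"
    unfolding A_def B_def c_def by (simp add: real_sqrt_mult)
qed

text \<open>Duality: integrating the inner product of \<open>f\<close> with its own packet expansion
  gives exactly the sum of the squared coefficients, and Cauchy-Schwarz bounds that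
  integral.\<close>

lemma sum_coefficients_le:
  fixes f :: "real \<Rightarrow> 'h::complex_hilbert" and w :: "'i \<Rightarrow> real \<Rightarrow> complex"
  assumes f: "(\<lambda>x. norm (f x)) \<in> borel_measurable lebesgue" "integrable lebesgue (\<lambda>x. (norm (f x))\<^sup>2)"
    and g: "(\<lambda>x. norm (\<Sum>i\<in>I. w i x *\<^sub>C a i)) \<in> borel_measurable lebesgue"
       "integrable lebesgue (\<lambda>x. (norm (\<Sum>i\<in>I. w i x *\<^sub>C a i))\<^sup>2)"
    and a: "\<And>i. i \<in> I \<Longrightarrow> a i = integral UNIV (\<lambda>x. cnj (w i x) *\<^sub>C f x)"
    and I: "finite I"
  shows "(\<Sum>i\<in>I. (norm (a i))\<^sup>2) \<le>
     sqrt (LINT x|lebesgue. (norm (f x))\<^sup>2) *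
     sqrt (LINT x|lebesgue. (norm (\<Sum>i\<in>I. w i x *\<^sub>C a i))\<^sup>2)"
proof -
  let ?g = "\<lambda>x. \<Sum>i\<in>I. w i x *\<^sub>C a i"
  have summand: "((\<lambda>x. cinner (f x) (w i x *\<^sub>C a i)) has_integral of_real ((norm (a i))\<^sup>2)) UNIV"
    if i: "i \<in> I" for i
  proof (cases "(\<lambda>x. cnj (w i x) *\<^sub>C f x) integrable_on UNIV")
    case True
    then have "((\<lambda>x. cnj (w i x) *\<^sub>C f x) has_integral a i) UNIV"
      by (simp add: a[OF i] integrable_integral)
    from has_integral_linear[OF this bounded_linear_cinner_left[of "a i"]]
    show ?thesis
      by (simp add: o_def cinner_scaleC_left cinner_scaleC_right cinner_self)
  next
    case False
    then have "a i = 0" \<comment> \<open>the value of an integral that does not exist\<close>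
      by (simp add: a[OF i] not_integrable_integral)
    then show ?thesis
      by (simp add: cinner_scaleC_right)
  qed
  have has: "((\<lambda>x. cinner (f x) (?g x)) has_integral of_real (\<Sum>i\<in>I. (norm (a i))\<^sup>2)) UNIV"
    unfolding cinner_sum_right of_real_sum by (intro has_integral_sum I summand)
  note CS = Cauchy_Schwarz_lebesgue_integral[OF f(1) g(1) f(2) g(2)]
  have "norm (integral UNIV (\<lambda>x. cinner (f x) (?g x))) \<le> integral UNIV (\<lambda>x. norm (f x) * norm (?g x))"
    by (intro integral_norm_bound_integral has_integral_integrable[OF has] integrable_on_lebesgue CS
        cinner_Cauchy_Schwarz)
  also have "\<dots> = (LINT x|lebesgue. norm (f x) * norm (?g x))"
    by (intro integral_lebesgue CS)
  also note CS(2)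
  finally show ?thesis
    unfolding integral_unique[OF has] norm_of_real by (simp add: sum_nonneg)
qed

section \<open>Dyadic intervals\<close>

lemma dyadic_gridE:
  assumes "J \<in> dyadic_grid t s" "s > 0"
  obtains n k where "J = {t + of_int n * (2 powi k * s) ..< t + (of_int n + 1) * (2 powi k * s)}"
    "len J = 2 powi k * s" "2 powi k * s > 0"
    "center J = t + (of_int n + 1 / 2) * (2 powi k * s)"
    "lower_half J = {t + of_int n * (2 powi k * s) ..< t + (of_int n + 1 / 2) * (2 powi k * s)}"
proof -
  obtain n k where J: "J = {t + of_int n * 2 powi k * s ..< t + (of_int n + 1) * 2 powi k * s}"
    using assms(1) unfolding dyadic_grid_def by blast
  define d where "d = 2 powi k * s"
  have d: "d > 0"
    using assms(2) by (simp add: d_def)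
  have J': "J = {t + of_int n * d ..< t + (of_int n + 1) * d}"
    by (simp add: J d_def mult.assoc)
  have lt: "t + of_int n * d < t + (of_int n + 1) * d"
    using d by (simp add: algebra_simps)
  have c: "center J = t + (of_int n + 1 / 2) * d"
    unfolding center_def J' using lt by (simp add: algebra_simps)
  have "lower_half J = {t + of_int n * d ..< t + (of_int n + 1 / 2) * d}"
    unfolding lower_half_def c unfolding J' using d by (auto simp: algebra_simps)
  moreover have "len J = d"
    unfolding J' using lt by (simp add: algebra_simps)
  ultimately show ?thesis
    using that[of n k] J' d c unfolding d_def by blast
qed

text \<open>In units of the shorter length, and relative to \<open>t\<close>, all four endpoints are
  integers. Overlap gives two strict inequalities between integers, which improve by one to the
  inequalities between endpoints.\<close>

lemma dyadic_nested:
  assumes J: "J \<in> dyadic_grid t s" and J': "J' \<in> dyadic_grid t s" and s: "s > 0"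
    and ne: "J \<inter> J' \<noteq> {}" and le: "len J \<le> len J'"
  shows "J \<subseteq> J'"
proof -
  obtain n k where 1: "J = {t + of_int n * (2 powi k * s) ..< t + (of_int n + 1) * (2 powi k * s)}"
    "len J = 2 powi k * s" "2 powi k * s > 0"
    using dyadic_gridE[OF J s] by metis
  obtain n' k' where 2: "J' = {t + of_int n' * (2 powi k' * s) ..< t + (of_int n' + 1) * (2 powi k' * s)}"
    "len J' = 2 powi k' * s"
    using dyadic_gridE[OF J' s] by metis
  define d where "d = 2 powi k * s"
  have d: "d > 0"
    using 1 by (simp add: d_def)
  have "(2::real) powi k \<le> 2 powi k'"
    using le s by (simp add: 1(2) 2(2))
  then have "k \<le> k'"
    using power_int_strict_increasing[of k' k "2::real"] by force
  define m where "m = nat (k' - k)"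
  have "k' = k + int m"
    using \<open>k \<le> k'\<close> by (simp add: m_def)
  then have k': "2 powi k' * s = 2 ^ m * d"
    by (simp add: d_def power_int_add)
  obtain x where x: "x \<in> J" "x \<in> J'"
    using ne by blast
  have "of_int n * d < (of_int n' + 1) * (2 ^ m * d)"
    using x unfolding 1 2 k' d_def[symmetric] by simp
  then have "real_of_int n < real_of_int ((n' + 1) * 2 ^ m)"
    using d by (simp flip: mult.assoc)
  then have A: "n + 1 \<le> (n' + 1) * 2 ^ m"
    by linarith
  have "of_int n' * (2 ^ m * d) < (of_int n + 1) * d"
    using x unfolding 1 2 k' d_def[symmetric] by simp
  then have "real_of_int (n' * 2 ^ m) < real_of_int (n + 1)"
    using d by (simp flip: mult.assoc)
  then have B: "n' * 2 ^ m \<le> n"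
    by linarith
  have "(of_int n + 1) * d \<le> (of_int n' + 1) * (2 ^ m * d)"
    using A[THEN of_int_le_iff[where 'a=real, THEN iffD2]] d by (simp flip: mult.assoc)
  moreover have "of_int n' * (2 ^ m * d) \<le> of_int n * d"
    using B[THEN of_int_le_iff[where 'a=real, THEN iffD2]] d by (simp flip: mult.assoc)
  ultimately show ?thesis
    unfolding 1 2 k' d_def[symmetric] by auto
qed

lemma lower_half_dyadic:
  assumes "J \<in> dyadic_grid t s" "s > 0"
  shows "lower_half J \<in> dyadic_grid t s" "len (lower_half J) = len J / 2"
proof -
  obtain n k where 1: "len J = 2 powi k * s" "2 powi k * s > 0"
    "lower_half J = {t + of_int n * (2 powi k * s) ..< t + (of_int n + 1 / 2) * (2 powi k * s)}"
    using dyadic_gridE[OF assms] by metis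
  have k: "2 powi k = 2 * (2::real) powi (k - 1)"
    by (simp add: power_int_diff)
  have "lower_half J = {t + of_int (2 * n) * 2 powi (k - 1) * s ..< t + (of_int (2 * n) + 1) * 2 powi (k - 1) * s}"
    unfolding 1 k by (simp add: algebra_simps)
  then show "lower_half J \<in> dyadic_grid t s"
    unfolding dyadic_grid_def by blast
  show "len (lower_half J) = len J / 2"
    using 1 by (simp add: algebra_simps)
qed

lemma dyadic_len_cases:
  assumes "J \<in> dyadic_grid t s" "J' \<in> dyadic_grid t s" "s > 0" "len J < len J'"
  shows "2 * len J \<le> len J'"
proof -
  obtain k where 1: "len J = 2 powi k * s"
    using dyadic_gridE[OF assms(1,3)] by metis
  obtain k' where 2: "len J' = 2 powi k' * s"
    using dyadic_gridE[OF assms(2,3)] by metis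
  have "(2::real) powi k < 2 powi k'"
    using assms(3,4) unfolding 1 2 by simp
  then have "\<not> k' \<le> k"
    using power_int_increasing[of k' k "2::real"] by auto
  then have "(2::real) powi (k + 1) \<le> 2 powi k'"
    by (intro power_int_increasing) auto
  then show ?thesis
    unfolding 1 2 using assms(3) by (simp add: power_int_add)
qed

text \<open>The lower half of a dyadic interval is again dyadic, with half the length. A strictly
  shorter dyadic interval is no longer than that, so meeting the lower half means lying inside it;
  equal lengths would give equal intervals.\<close>

lemma dyadic_in_lower_half:
  assumes J: "J \<in> dyadic_grid t s" and J': "J' \<in> dyadic_grid t s" and s: "s > 0"
    and ne: "lower_half J \<inter> lower_half J' \<noteq> {}" and neq: "J \<noteq> J'"
  shows "J \<subseteq> lower_half J' \<or> J' \<subseteq> lower_half J"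
proof -
  have *: "A \<subseteq> lower_half B"
    if A: "A \<in> dyadic_grid t s" and B: "B \<in> dyadic_grid t s" and lt: "len A < len B"
      and ne: "lower_half A \<inter> lower_half B \<noteq> {}" for A B
  proof (rule dyadic_nested[OF A lower_half_dyadic(1)[OF B s] s])
    show "A \<inter> lower_half B \<noteq> {}"
      using ne unfolding lower_half_def by blast
    show "len A \<le> len (lower_half B)"
      using dyadic_len_cases[OF A B s lt] lower_half_dyadic(2)[OF B s] by simp
  qed
  have "J \<inter> J' \<noteq> {}"
    using ne unfolding lower_half_def by blast
  then have "len J \<noteq> len J'"
    using dyadic_nested[OF J J' s] dyadic_nested[OF J' J s] neq by (metis inf_commute order_refl subset_antisym)
  then show ?thesis
    using *[OF J J'] *[OF J' J] ne by (metis inf_commute linorder_neqE_linordered_idom)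
qed

lemma dyadic_nonempty:
  assumes "J \<in> dyadic_grid t s" "s > 0"
  shows "J \<noteq> {}" "lower_half J \<noteq> {}" "len J > 0" "J \<in> sets lborel"
proof -
  obtain n k where 1: "J = {t + of_int n * (2 powi k * s) ..< t + (of_int n + 1) * (2 powi k * s)}"
    "len J = 2 powi k * s" "2 powi k * s > 0"
    "lower_half J = {t + of_int n * (2 powi k * s) ..< t + (of_int n + 1 / 2) * (2 powi k * s)}"
    using dyadic_gridE[OF assms] by metis
  show "J \<noteq> {}" "lower_half J \<noteq> {}" "len J > 0" "J \<in> sets lborel"
    using 1 by (auto simp: algebra_simps)
qed

lemma dyadic_explicit:
  assumes "J \<in> dyadic_grid t s" "s > 0"
  shows "J = {center J - len J / 2 ..< center J + len J / 2}"
    and "lower_half J = {center J - len J / 2 ..< center J}"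
    and "center (lower_half J) = center J - len J / 4"
proof -
  obtain n k where 1: "J = {t + of_int n * (2 powi k * s) ..< t + (of_int n + 1) * (2 powi k * s)}"
    "len J = 2 powi k * s" "2 powi k * s > 0"
    "center J = t + (of_int n + 1 / 2) * (2 powi k * s)"
    "lower_half J = {t + of_int n * (2 powi k * s) ..< t + (of_int n + 1 / 2) * (2 powi k * s)}"
    using dyadic_gridE[OF assms] by metis
  show "J = {center J - len J / 2 ..< center J + len J / 2}"
    unfolding 1(2,4) by (subst 1(1)) (simp add: algebra_simps)
  show l: "lower_half J = {center J - len J / 2 ..< center J}"
    unfolding 1(2,4,5) by (simp add: algebra_simps)
  show "center (lower_half J) = center J - len J / 4"
  proof -
    have "0 < len J"
      using 1 by simp
    then show ?thesis
      unfolding l unfolding center_def[of "{_..<_}"] by (simp add: field_simps)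
  qed
qed

text \<open>A geometric series: every element other than the largest one \<open>m\<close> is at most
  \<open>m / 2\<close>, so induction on the cardinality gives
  \<open>m + 2 * (m / 2)\<close>.\<close>

lemma dyadic_lens_sum:
  assumes A: "finite A" "\<And>x. x \<in> A \<Longrightarrow> x \<le> L" "\<And>x. x \<in> A \<Longrightarrow> x > (0::real)"
    and L: "L \<ge> 0"
    and gap: "\<And>x y. x \<in> A \<Longrightarrow> y \<in> A \<Longrightarrow> x < y \<Longrightarrow> 2 * x \<le> y"
  shows "(\<Sum>x\<in>A. x) \<le> 2 * L"
  using A L gap
proof (induction "card A" arbitrary: A L rule: less_induct)
  case less
  show ?case
  proof (cases "A = {}")
    case True
    then show ?thesis
      using less.prems by simp
  next
    case False
    define m where "m = Max A"
    have m: "m \<in> A" "\<And>x. x \<in> A \<Longrightarrow> x \<le> m"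
      using False less.prems by (auto simp: m_def)
    have "(\<Sum>x\<in>A - {m}. x) \<le> 2 * (m / 2)"
    proof (rule less.hyps)
      show "card (A - {m}) < card A"
        using m less.prems by (meson card_Diff1_less)
      show "x \<le> m / 2" if "x \<in> A - {m}" for x
        using that m less.prems(5)[of x m] by force
    qed (use less.prems m in \<open>auto simp: less_imp_le\<close>)
    moreover have "(\<Sum>x\<in>A. x) = m + (\<Sum>x\<in>A - {m}. x)"
      using m less.prems by (simp add: sum.remove)
    ultimately show ?thesis
      using less.prems(2)[OF m(1)] by simp
  qed
qed

lemma dyadic_len_mono:
  assumes J: "J \<in> dyadic_grid t s" and J': "J' \<in> dyadic_grid t s" and s: "s > 0" and sub: "J \<subseteq> J'"
  shows "len J \<le> len J'"
proof (rule measure_mono_fmeasurable[OF sub])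
  show "J \<in> sets lborel"
    using dyadic_nonempty(4)[OF J s] .
  have "{center J' - len J' / 2 ..< center J' + len J' / 2} \<in> fmeasurable lborel"
    using dyadic_nonempty(3)[OF J' s] by (simp add: fmeasurable_def)
  then show "J' \<in> fmeasurable lborel"
    using dyadic_explicit(1)[OF J' s] by simp
qed

lemma dyadic_linear:
  assumes "J \<in> dyadic_grid t s" "J' \<in> dyadic_grid t s" "s > 0" "J \<inter> J' \<noteq> {}"
  shows "J \<subseteq> J' \<or> J' \<subseteq> J"
proof (cases "len J \<le> len J'")
  case True
  then show ?thesis
    using dyadic_nested assms by blast
next
  case False
  moreover have "J' \<inter> J \<noteq> {}"
    using assms(4) by blast
  ultimately show ?thesis
    using dyadic_nested[OF assms(2,1,3)] by simp
qed

section \<open>Wave packets\<close>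

lemma integrable_rescale:
  fixes f :: "real \<Rightarrow> 'a :: {banach, second_countable_topology}"
  assumes "s > 0" "integrable lborel f"
  shows "integrable lborel (\<lambda>x. f ((x - c) / s))"
  using lborel_integrable_real_affine[OF assms(2), of "1 / s" "- c / s"] assms(1)
  by (simp add: field_simps)

lemma integral_rescale:
  fixes f :: "real \<Rightarrow> 'a :: {banach, second_countable_topology}"
  assumes "s > 0"
  shows "(LINT x|lborel. f ((x - c) / s)) = s *\<^sub>R (LINT x|lborel. f x)"
proof -
  have "(LINT x|lborel. f x) = \<bar>1 / s\<bar> *\<^sub>R (LINT x|lborel. f (- c / s + 1 / s * x))"
    by (rule lborel_integral_real_affine) (use assms in simp)
  then show ?thesis
    using assms by (simp add: field_simps)
qed

text \<open>The decay majorant for all packets: its integral is pi, it decreases in the absolute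
  value, and a product of two values is controlled by the value at the sum
  (\<open>bump_mult_le\<close>).\<close>

definition bump :: "real \<Rightarrow> real"
  where "bump x = 1 / (1 + x\<^sup>2)"

lemma bump_pos [simp]: "bump x > 0"
  by (simp add: bump_def add_pos_nonneg)

lemma bump_nonneg [simp]: "bump x \<ge> 0"
  by (simp add: less_imp_le)

lemma bump_le_1 [simp]: "bump x \<le> 1"
  by (simp add: bump_def add_pos_nonneg)

lemma bump_measurable [measurable]: "bump \<in> borel_measurable borel"
  unfolding bump_def by measurable

lemma integrable_bump: "integrable lborel bump"
  using integrable_inverse_1_plus_square
  by (simp add: set_integrable_def bump_def[abs_def] inverse_eq_divide)

lemma integral_bump: "(LINT x|lborel. bump x) = pi"
  using LBINT_inverse_1_plus_square
  by (simp add: interval_lebesgue_integral_def set_lebesgue_integral_def bump_def inverse_eq_divide)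

lemma bump_mono: "\<bar>x\<bar> \<le> \<bar>y\<bar> \<Longrightarrow> bump y \<le> bump x"
  unfolding bump_def by (intro divide_left_mono) (auto simp: abs_le_square_iff add_pos_nonneg)

text \<open>After clearing denominators the two sides differ by
  \<open>(a - b)\<^sup>2 + 1 + 2 * (a * b)\<^sup>2\<close>.\<close>

lemma bump_mult_le: "bump a * bump b \<le> 2 * bump (a + b)"
proof -
  have "1 + (a + b)\<^sup>2 \<le> 2 * ((1 + a\<^sup>2) * (1 + b\<^sup>2))"
  proof -
    have "0 \<le> (a - b)\<^sup>2 + 1 + 2 * (a * b)\<^sup>2"
      by simp
    then show ?thesis
      by (simp add: power2_eq_square algebra_simps)
  qed
  then show ?thesis
    unfolding bump_def by (simp add: field_simps add_pos_nonneg)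
qed

lemma schwartz_continuous: "schwartz f \<Longrightarrow> continuous_on UNIV f"
  unfolding schwartz_def continuous_on_eq_continuous_at[OF open_UNIV]
  using has_vector_derivative_continuous by blast

text \<open>Three factors of \<open>bump\<close> are provided because the inner product estimate
  spends two on the distance of the centers and integrates the third. Of those two, one later
  becomes the tree weight and the other makes the sum over tiles converge.\<close>

lemma schwartz_decay:
  assumes "schwartz f"
  obtains K where "K > 0" "\<And>x. norm (f x) \<le> K * bump x ^ 3"
proof -
  have "bounded (range (\<lambda>x. x ^ k *\<^sub>R f x))" for k
    using assms unfolding schwartz_def by blast
  then have "\<exists>B. \<forall>x. norm (x ^ k *\<^sub>R f x) \<le> B" for k
    unfolding bounded_iff by blast
  then obtain B where B: "\<And>k x. norm (x ^ k *\<^sub>R f x) \<le> B k"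
    by metis
  \<comment> \<open>Binomial coefficients of \<open>(1 + x\<^sup>2) ^ 3\<close>, each even power of
    \<open>x\<close> being absorbed by a Schwartz seminorm.\<close>
  have le: "norm (f x) * (1 + x\<^sup>2) ^ 3 \<le> B 0 + 3 * B 2 + 3 * B 4 + B 6" for x
  proof -
    define y where "y = norm (f x)"
    have e: "\<bar>x\<bar> ^ k = x ^ k" if "even k" for k
      using that by (metis power_even_abs)
    have "y \<le> B 0" "x ^ 2 * y \<le> B 2" "x ^ 4 * y \<le> B 4" "x ^ 6 * y \<le> B 6"
      using B[of x 0] B[of x 2] B[of x 4] B[of x 6] by (simp_all add: power_abs e y_def)
    moreover have "y * (1 + x\<^sup>2) ^ 3 = y + 3 * (x ^ 2 * y) + 3 * (x ^ 4 * y) + x ^ 6 * y"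
      by (simp add: eval_nat_numeral algebra_simps)
    ultimately show ?thesis
      unfolding y_def by linarith
  qed
  define K where "K = \<bar>B 0 + 3 * B 2 + 3 * B 4 + B 6\<bar> + 1"
  show ?thesis
  proof
    show "K > 0" by (simp add: K_def)
    show "norm (f x) \<le> K * bump x ^ 3" for x
    proof -
      have "norm (f x) * (1 + x\<^sup>2) ^ 3 \<le> K"
        using le[of x] unfolding K_def by linarith
      then show ?thesis
        unfolding bump_def by (simp add: power_divide pos_le_divide_eq add_pos_nonneg)
    qed
  qed
qed

text \<open>Frequency, center and scale are free parameters here, so that the Fourier analysis
  involves no tiles.\<close>

definition packet :: "(real \<Rightarrow> complex) \<Rightarrow> real \<Rightarrow> real \<Rightarrow> real \<Rightarrow> real \<Rightarrow> complex"
  where "packet \<phi> \<eta> c s x = cis (2 * pi * \<eta> * x) * complex_of_real (s powr (- 1 / 2)) * \<phi> ((x - c) / s)"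

lemma wave_packet_eq_packet:
  "wave_packet \<phi> P = packet \<phi> (center (lower_half (freq_interval P))) (center (time_interval P)) (len (time_interval P))"
  by (simp add: wave_packet_def packet_def fun_eq_iff)

text \<open>The decay constant \<open>K\<close> is fixed together with the profile, so constants
  built from \<phi> and \<open>K\<close> are uniform in the grids, the trees and the
  function.\<close>

locale profile =
  fixes \<phi> :: "real \<Rightarrow> complex" and K :: real
  assumes profile: "wave_packet_profile \<phi>"
    and K: "K > 0"
    and decay: "\<And>x. norm (\<phi> x) \<le> K * bump x ^ 3"
begin

lemma cont: "continuous_on UNIV \<phi>"
  using profile schwartz_continuous unfolding wave_packet_profile_def by blast

lemma phi_measurable [measurable]: "\<phi> \<in> borel_measurable borel"
  by (intro borel_measurable_continuous_onI cont)

lemma norm_le: "norm (\<phi> x) \<le> K * bump x"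
proof -
  have "bump x ^ 3 \<le> bump x"
    using power_decreasing[of 1 3 "bump x"] by simp
  then show ?thesis
    using decay[of x] K by (meson mult_left_mono order_trans less_imp_le)
qed

lemma norm_le_K: "norm (\<phi> x) \<le> K"
proof -
  have "K * bump x \<le> K * 1"
    using K by (intro mult_left_mono) auto
  then show ?thesis
    using norm_le[of x] by simp
qed

lemma integrable_phi: "integrable lborel \<phi>"
proof (rule Bochner_Integration.integrable_bound)
  show "integrable lborel (\<lambda>x. K * bump x)"
    using integrable_bump by simp
  show "AE x in lborel. norm (\<phi> x) \<le> norm (K * bump x)"
    using norm_le K by (auto simp: abs_mult intro: order_trans[OF _ abs_ge_self])
qed measurable

lemma fourier_supp: "fourier \<phi> \<xi> \<noteq> 0 \<Longrightarrow> \<bar>\<xi>\<bar> \<le> 1 / 20"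
  using profile unfolding wave_packet_profile_def by force

lemma fourier_measurable [measurable]: "fourier \<phi> \<in> borel_measurable borel"
proof -
  have "(\<lambda>p. \<phi> (snd p) * cis (- 2 * pi * snd p * fst p)) \<in> borel_measurable (borel \<Otimes>\<^sub>M lborel)"
    by (simp add: borel_measurable_continuous_onI continuous_intros
      continuous_on_compose2[OF cont] borel_prod[symmetric] cong: measurable_cong_sets)
  then have "(\<lambda>\<xi>. LINT x|lborel. \<phi> x * cis (- 2 * pi * x * \<xi>)) \<in> borel_measurable borel"
    by (intro lborel.borel_measurable_lebesgue_integral) (simp add: case_prod_beta')
  then show ?thesis
    unfolding fourier_def[abs_def] .
qed

lemma fourier_bound: "norm (fourier \<phi> \<xi>) \<le> (LINT x|lborel. norm (\<phi> x))"
  unfolding fourier_def by (rule integral_norm_bound[THEN order_trans]) (simp add: norm_mult)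

lemma integrable_fourier: "integrable lborel (fourier \<phi>)"
proof (rule Bochner_Integration.integrable_bound)
  show "integrable lborel (\<lambda>\<xi>. (LINT x|lborel. norm (\<phi> x)) * indicator {-1/20..1/20::real} \<xi>)"
    by (simp add: integrable_mult_right)
  show "AE \<xi> in lborel. norm (fourier \<phi> \<xi>) \<le> norm ((LINT x|lborel. norm (\<phi> x)) * indicator {-1/20..1/20} \<xi>)"
    using fourier_bound fourier_supp
    by (intro AE_I2) (fastforce simp: indicator_def)
qed measurable

section \<open>Size and Fourier transform of a single packet\<close>

context
  fixes \<eta> c s :: real
  assumes s: "s > 0"
begin

lemma continuous_packet: "continuous_on UNIV (packet \<phi> \<eta> c s)"
  unfolding packet_def using s by (intro continuous_intros continuous_on_compose2[OF cont]) auto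

lemma packet_measurable: "packet \<phi> \<eta> c s \<in> borel_measurable borel"
  by (intro borel_measurable_continuous_onI continuous_packet)

lemma norm_packet: "norm (packet \<phi> \<eta> c s x) = s powr (- 1 / 2) * norm (\<phi> ((x - c) / s))"
  using s by (simp add: packet_def norm_mult)

lemma integrable_packet: "integrable lborel (packet \<phi> \<eta> c s)"
proof (rule Bochner_Integration.integrable_bound)
  show "integrable lborel (\<lambda>x. s powr (- 1 / 2) * norm (\<phi> ((x - c) / s)))"
    using integrable_rescale[OF s integrable_phi, of c] by simp
qed (use packet_measurable norm_packet in auto)

lemma norm_packet_le: "norm (packet \<phi> \<eta> c s x) \<le> s powr (- 1 / 2) * K"
  unfolding norm_packet by (intro mult_left_mono norm_le_K) simp

lemma integral_norm_packet:
  "(LINT x|lborel. norm (packet \<phi> \<eta> c s x)) = sqrt s * (LINT x|lborel. norm (\<phi> x))"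
proof -
  have "(LINT x|lborel. norm (packet \<phi> \<eta> c s x)) = (s powr (- 1 / 2) * s) * (LINT x|lborel. norm (\<phi> x))"
    unfolding norm_packet using integral_rescale[OF s, of "\<lambda>x. norm (\<phi> x)" c] by simp
  also have "s powr (- 1 / 2) * s = sqrt s"
    using s powr_add[of s "-1/2" 1] by (simp add: powr_half_sqrt)
  finally show ?thesis .
qed

text \<open>Covariance under dilation, translation and modulation: the transform sits at frequency
  \<eta> on the scale \<open>1 / s\<close>, and the center \<open>c\<close> enters only as a
  phase.\<close>

lemma fourier_packet:
  "fourier (packet \<phi> \<eta> c s) \<xi> = of_real (sqrt s) * cis (- 2 * pi * c * (\<xi> - \<eta>)) * fourier \<phi> (s * (\<xi> - \<eta>))"
proof -
  have "fourier (packet \<phi> \<eta> c s) \<xi> = \<bar>s\<bar> *\<^sub>R (LINT x|lborel. packet \<phi> \<eta> c s (c + s * x) * cis (- 2 * pi * (c + s * x) * \<xi>))"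
    unfolding fourier_def by (rule lborel_integral_real_affine) (use s in simp)
  also have "(\<lambda>x. packet \<phi> \<eta> c s (c + s * x) * cis (- 2 * pi * (c + s * x) * \<xi>)) =
    (\<lambda>x. (of_real (s powr (- 1 / 2)) * cis (- 2 * pi * c * (\<xi> - \<eta>))) * (\<phi> x * cis (- 2 * pi * x * (s * (\<xi> - \<eta>)))))"
  proof
    fix x
    have "cis (2 * pi * \<eta> * (c + s * x)) * cis (- 2 * pi * (c + s * x) * \<xi>) =
       cis (- 2 * pi * c * (\<xi> - \<eta>)) * cis (- 2 * pi * x * (s * (\<xi> - \<eta>)))"
      unfolding cis_mult by (simp add: algebra_simps)
    then show "packet \<phi> \<eta> c s (c + s * x) * cis (- 2 * pi * (c + s * x) * \<xi>) =
       (of_real (s powr (- 1 / 2)) * cis (- 2 * pi * c * (\<xi> - \<eta>))) * (\<phi> x * cis (- 2 * pi * x * (s * (\<xi> - \<eta>))))"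
      unfolding packet_def using s by (simp add: mult_ac)
  qed
  also have "(LINT x|lborel. \<dots> x) = of_real (s powr (- 1 / 2)) * cis (- 2 * pi * c * (\<xi> - \<eta>)) * fourier \<phi> (s * (\<xi> - \<eta>))"
    unfolding fourier_def by (subst integral_mult_right_zero) simp
  also have "\<bar>s\<bar> *\<^sub>R \<dots> = of_real (s * s powr (- 1 / 2)) * cis (- 2 * pi * c * (\<xi> - \<eta>)) * fourier \<phi> (s * (\<xi> - \<eta>))"
    using s by (simp add: scaleR_conv_of_real mult.assoc)
  also have "s * s powr (- 1 / 2) = sqrt s"
    using s powr_add[of s 1 "-1/2"] by (simp add: powr_half_sqrt)
  finally show ?thesis .
qed

lemma integrable_fourier_packet: "integrable lborel (fourier (packet \<phi> \<eta> c s))"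
proof (rule Bochner_Integration.integrable_bound)
  show "integrable lborel (\<lambda>\<xi>. sqrt s * norm (fourier \<phi> (s * (\<xi> - \<eta>))))"
    using lborel_integrable_real_affine[OF integrable_fourier, of s "- s * \<eta>"] s
    by (simp add: algebra_simps)
  show "fourier (packet \<phi> \<eta> c s) \<in> borel_measurable lborel"
    unfolding fourier_packet[abs_def] by measurable
qed (use s in \<open>simp add: fourier_packet norm_mult\<close>)

end

section \<open>Orthogonality of packets\<close>

lemma packet_parseval:
  assumes "s > 0" "s' > 0"
  shows "(LINT x|lborel. packet \<phi> \<eta> c s x * cnj (packet \<phi> \<eta>' c' s' x)) =
    (LINT \<xi>|lborel. fourier (packet \<phi> \<eta> c s) \<xi> * cnj (fourier (packet \<phi> \<eta>' c' s') \<xi>))"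
  by (rule fourier_parseval[OF integrable_packet[OF assms(1)] continuous_packet[OF assms(1)]
      norm_packet_le[OF assms(1)] integrable_fourier_packet[OF assms(1)] integrable_packet[OF assms(2)]])

text \<open>By Parseval: the transforms are supported within \<open>1 / (20 * s)\<close> and
  \<open>1 / (20 * s')\<close> of their frequencies, and \<open>sep\<close> keeps these supports
  apart.\<close>

lemma packet_orthogonal_freq:
  assumes s: "s > 0" "s' > 0" and sep: "\<bar>\<eta> - \<eta>'\<bar> > 1 / (20 * s) + 1 / (20 * s')"
  shows "(LINT x|lborel. packet \<phi> \<eta> c s x * cnj (packet \<phi> \<eta>' c' s' x)) = 0"
proof -
  have *: "fourier (packet \<phi> \<eta> c s) \<xi> * cnj (fourier (packet \<phi> \<eta>' c' s') \<xi>) = 0" for \<xi>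
  proof (rule ccontr)
    assume "\<not> ?thesis"
    then have "\<bar>s * (\<xi> - \<eta>)\<bar> \<le> 1 / 20" "\<bar>s' * (\<xi> - \<eta>')\<bar> \<le> 1 / 20"
      using s fourier_supp[of "s * (\<xi> - \<eta>)"] fourier_supp[of "s' * (\<xi> - \<eta>')"]
      by (auto simp: fourier_packet)
    then have "s * \<bar>\<xi> - \<eta>\<bar> \<le> 1 / 20" "s' * \<bar>\<xi> - \<eta>'\<bar> \<le> 1 / 20"
      using s by (simp_all only: abs_mult abs_of_pos)
    then have "\<bar>\<xi> - \<eta>\<bar> \<le> 1 / (20 * s)" "\<bar>\<xi> - \<eta>'\<bar> \<le> 1 / (20 * s')"
      using s by (simp_all add: field_simps)
    then show False
      using sep by linarith
  qed
  show ?thesis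
    unfolding packet_parseval[OF s] * by simp
qed

lemma packet_norm_sq:
  assumes s: "s > 0"
  shows "(LINT x|lborel. packet \<phi> \<eta> c s x * cnj (packet \<phi> \<eta> c s x)) = of_real (LINT x|lborel. (norm (\<phi> x))\<^sup>2)"
proof -
  have "packet \<phi> \<eta> c s x * cnj (packet \<phi> \<eta> c s x) = of_real ((norm (\<phi> ((x - c) / s)))\<^sup>2 / s)" for x
    unfolding complex_norm_square[symmetric] norm_packet[OF s]
    using s powr_add[of s "-1/2" "-1/2"] by (simp add: power_mult_distrib power2_eq_square powr_minus_divide)
  then have "(LINT x|lborel. packet \<phi> \<eta> c s x * cnj (packet \<phi> \<eta> c s x)) =
    of_real ((LINT x|lborel. (norm (\<phi> ((x - c) / s)))\<^sup>2) / s)"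
    by (simp only: integral_complex_of_real) simp
  also have "(LINT x|lborel. (norm (\<phi> ((x - c) / s)))\<^sup>2) = s * (LINT x|lborel. (norm (\<phi> x))\<^sup>2)"
    using integral_rescale[OF s, of "\<lambda>x. (norm (\<phi> x))\<^sup>2" c] by simp
  finally show ?thesis
    using s by simp
qed

lemma fourier_cnj: "cnj (fourier \<phi> \<xi>) = fourier \<phi> \<xi>"
  using profile unfolding wave_packet_profile_def
  by (meson Reals_cnj_iff nonneg_Reals_subset_Reals subsetD)

text \<open>The transform vanishes outside [-1/20, 1/20], so for \<open>y\<close> strictly between 0
  and 1/20 only the shifts by 0 and -1/20 contribute to the constant periodization.\<close>

lemma fourier_sq_periodization:
  obtains b where "\<And>y. y \<in> {0<..<1/20} \<Longrightarrow> (fourier \<phi> y)\<^sup>2 + (fourier \<phi> (y - 1 / 20))\<^sup>2 = b"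
proof -
  obtain b where b: "\<And>\<xi>. ((\<lambda>n::int. (fourier \<phi> (\<xi> + of_int n / 20))\<^sup>2) has_sum b) UNIV"
    using profile unfolding wave_packet_profile_def by blast
  have "(fourier \<phi> y)\<^sup>2 + (fourier \<phi> (y - 1 / 20))\<^sup>2 = b" if y: "y \<in> {0<..<1/20}" for y
  proof -
    have z: "fourier \<phi> (y + of_int n / 20) = 0" if "n \<in> UNIV - {-1, 0}" for n :: int
    proof (rule ccontr)
      assume "\<not> ?thesis"
      then have "\<bar>y + of_int n / 20\<bar> \<le> 1 / 20"
        by (rule fourier_supp)
      moreover have "n \<ge> 1 \<or> n \<le> -2"
        using that by auto
      then have "real_of_int n \<ge> 1 \<or> real_of_int n \<le> -2"
        by linarith
      ultimately show False
        using y by auto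
    qed
    have "((\<lambda>n::int. (fourier \<phi> (y + of_int n / 20))\<^sup>2) has_sum b) {-1, 0}"
      by (rule has_sum_cong_neutral[THEN iffD1, OF _ _ _ b[of y]]) (use z in auto)
    moreover have "((\<lambda>n::int. (fourier \<phi> (y + of_int n / 20))\<^sup>2) has_sum
        (\<Sum>n\<in>{-1, 0}. (fourier \<phi> (y + of_int n / 20))\<^sup>2)) {-1, 0}"
      by (rule has_sum_finite) simp
    ultimately have "b = (\<Sum>n\<in>{-1, 0::int}. (fourier \<phi> (y + of_int n / 20))\<^sup>2)"
      by (rule has_sum_unique)
    then show ?thesis
      by (simp add: add.commute)
  qed
  then show ?thesis
    using that by blast
qed

text \<open>On an interval of length 1/20 the exponential runs through a nonzero whole number of
  periods.\<close>

lemma integral_cis_period: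
  assumes "n \<noteq> (0::int)"
  shows "(LINT y|lborel. indicator {0<..<1/20::real} y *\<^sub>R cis (40 * pi * of_int n * y)) = 0"
proof -
  define a where "a = 40 * pi * real_of_int n"
  have a: "a \<noteq> 0"
    using assms by (simp add: a_def)
  have cont: "continuous_on {0..1/20} (\<lambda>y. cis (a * y))"
    by (intro continuous_intros)
  have "((\<lambda>y. cis (a * y) / (\<i> * of_real a)) has_vector_derivative cis (a * y)) (at y within {0..1/20})" for y
  proof -
    have "((\<lambda>z. exp (\<i> * of_real a * z) / (\<i> * of_real a)) has_field_derivative exp (\<i> * of_real a * of_real y)) (at (of_real y))"
      using a by (auto intro!: derivative_eq_intros)
    from has_vector_derivative_real_field[OF this] show ?thesis
      by (simp add: cis_conv_exp mult_ac)
  qed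
  then have "((\<lambda>y. cis (a * y)) has_integral (cis (a * (1/20)) / (\<i> * of_real a) - cis (a * 0) / (\<i> * of_real a))) {0..1/20}"
    by (intro fundamental_theorem_of_calculus) auto
  moreover have "cis (a * (1/20)) = 1"
    using cis_multiple_2pi[of "of_int n"] by (simp add: a_def mult_ac)
  ultimately have "integral {0..1/20} (\<lambda>y. cis (a * y)) = 0"
    by (simp add: integral_unique)
  moreover have "set_integrable lborel {0..1/20} (\<lambda>y. cis (a * y))"
    unfolding set_integrable_def by (intro borel_integrable_compact cont) simp
  ultimately have "(LINT y:{0..1/20}|lborel. cis (a * y)) = 0"
    using set_borel_integral_eq_integral by metis
  moreover have "(LINT y:{0..1/20}|lborel. cis (a * y)) =
    (LINT y|lborel. indicator {0<..<1/20} y *\<^sub>R cis (a * y))"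
    unfolding set_lebesgue_integral_def
  proof (intro integral_cong_AE)
    show "AE y in lborel. indicator {0..1/20} y *\<^sub>R cis (a * y) = indicator {0<..<1/20} y *\<^sub>R cis (a * y)"
      using AE_lborel_singleton[of "0::real"] AE_lborel_singleton[of "1/20::real"]
      by eventually_elim (auto simp: indicator_def)
  qed measurable
  ultimately show ?thesis
    by (simp add: a_def)
qed

text \<open>Folding: 1/20 is a period of the exponential, so shifting the part over (-1/20, 0) by
  1/20 adds the two squares up to the constant \<open>b\<close>. What remains is \<open>b\<close>
  times the integral of the exponential over (0, 1/20), which vanishes.\<close>

lemma integral_fourier_sq_cis:
  assumes n: "n \<noteq> (0::int)"
  shows "(LINT y|lborel. (fourier \<phi> y)\<^sup>2 * cis (40 * pi * of_int n * y)) = 0"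
proof -
  obtain b where b: "\<And>y. y \<in> {0<..<1/20} \<Longrightarrow> (fourier \<phi> y)\<^sup>2 + (fourier \<phi> (y - 1 / 20))\<^sup>2 = b"
    using fourier_sq_periodization by blast
  define h where "h y = (fourier \<phi> y)\<^sup>2 * cis (40 * pi * of_int n * y)" for y
  have [measurable]: "h \<in> borel_measurable borel"
    unfolding h_def by measurable
  have "integrable lborel h"
  proof (rule Bochner_Integration.integrable_bound)
    show "integrable lborel (\<lambda>\<xi>. (LINT x|lborel. norm (\<phi> x)) * norm (fourier \<phi> \<xi>))"
      using integrable_fourier by simp
    show "AE \<xi> in lborel. norm (h \<xi>) \<le> norm ((LINT x|lborel. norm (\<phi> x)) * norm (fourier \<phi> \<xi>))"
      unfolding h_def using fourier_bound
      by (auto simp: norm_mult power2_eq_square abs_mult intro!: AE_I2 mult_right_mono)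
  qed measurable
  then have int: "integrable lborel (\<lambda>y. indicator A y *\<^sub>R h y)" if "A \<in> sets borel" for A
    using that by (intro integrable_mult_indicator) auto
  define I where "I = (LINT y|lborel. indicator {-1/20<..<0} y *\<^sub>R h y)"
  define J where "J = (LINT y|lborel. indicator {0<..<1/20} y *\<^sub>R h y)"
  have "(LINT y|lborel. h y) = (LINT y|lborel. indicator {-1/20<..<0} y *\<^sub>R h y + indicator {0<..<1/20} y *\<^sub>R h y)"
  proof (intro integral_cong_AE)
    show "AE y in lborel. h y = indicator {-1/20<..<0} y *\<^sub>R h y + indicator {0<..<1/20} y *\<^sub>R h y"
      using AE_lborel_singleton[of 0] AE_lborel_singleton[of "1/20"] AE_lborel_singleton[of "-1/20"]
    proof eventually_elim
      case (elim y)
      have "h y = 0" if "\<bar>y\<bar> > 1 / 20"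
        using that fourier_supp[of y] by (auto simp: h_def)
      then show ?case
        using elim by (auto simp: indicator_def abs_if split: if_splits)
    qed
  qed (use int in auto)
  also have "\<dots> = I + J"
    unfolding I_def J_def by (intro Bochner_Integration.integral_add int) auto
  finally have IJ: "(LINT y|lborel. h y) = I + J" .
  have I: "I =
      (LINT y|lborel. indicator {0<..<1/20} y *\<^sub>R ((fourier \<phi> (y - 1 / 20))\<^sup>2 * cis (40 * pi * of_int n * y)))"
  proof -
    have "(LINT y|lborel. indicator {-1/20<..<0} y *\<^sub>R h y) =
      \<bar>1\<bar> *\<^sub>R (LINT y|lborel. indicator {-1/20<..<0} (- 1 / 20 + 1 * y) *\<^sub>R h (- 1 / 20 + 1 * y))"
      by (rule lborel_integral_real_affine) simp
    also have "(\<lambda>y. indicator {-1/20<..<0} (- 1 / 20 + 1 * y) *\<^sub>R h (- 1 / 20 + 1 * y)) =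
      (\<lambda>y. indicator {0<..<1/20} y *\<^sub>R ((fourier \<phi> (y - 1 / 20))\<^sup>2 * cis (40 * pi * of_int n * y)))"
    proof
      fix y :: real
      have "cis (40 * pi * of_int n * y) = cis (40 * pi * of_int n * (y - 1 / 20)) * cis (2 * pi * of_int n)"
        unfolding cis_mult by (simp add: algebra_simps)
      moreover have "cis (2 * pi * of_int n) = 1"
        using cis_multiple_2pi[of "of_int n"] by (simp add: mult_ac)
      ultimately show "indicator {-1/20<..<0} (- 1 / 20 + 1 * y) *\<^sub>R h (- 1 / 20 + 1 * y) =
          indicator {0<..<1/20} y *\<^sub>R ((fourier \<phi> (y - 1 / 20))\<^sup>2 * cis (40 * pi * of_int n * y))"
        by (auto simp: h_def indicator_def)
    qed
    finally show ?thesis by (simp add: I_def)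
  qed
  define E where "E y = indicator {0<..<1/20::real} y *\<^sub>R cis (40 * pi * of_int n * y)" for y
  have "integrable lborel E"
  proof (rule Bochner_Integration.integrable_bound)
    show "integrable lborel (indicator {0<..<1/20::real} :: real \<Rightarrow> real)"
      by simp
    show "E \<in> borel_measurable lborel"
      unfolding E_def by measurable
    show "AE y in lborel. norm (E y) \<le> norm (indicator {0<..<1/20::real} y :: real)"
      by (intro AE_I2) (simp add: E_def)
  qed
  then have "integrable lborel (\<lambda>y. b * E y)"
    by simp
  have split: "indicator {0<..<1/20} y *\<^sub>R ((fourier \<phi> (y - 1 / 20))\<^sup>2 * cis (40 * pi * of_int n * y))
      = b * E y - indicator {0<..<1/20} y *\<^sub>R h y" for y
  proof (cases "y \<in> {0<..<1/20}")
    case True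
    show ?thesis
      unfolding b[OF True, symmetric] E_def h_def using True by (simp add: algebra_simps)
  qed (simp add: E_def)
  have "I = (LINT y|lborel. b * E y) - J"
    unfolding I split J_def
    by (intro Bochner_Integration.integral_diff int \<open>integrable lborel (\<lambda>y. b * E y)\<close>) auto
  then have "I + J = (LINT y|lborel. b * E y)"
    by simp
  also have "\<dots> = b * (LINT y|lborel. E y)"
    by (rule integral_mult_right_zero)
  also have "\<dots> = 0"
    unfolding E_def using integral_cis_period[OF n] by simp
  finally show ?thesis
    using IJ unfolding h_def by simp
qed

text \<open>The two transforms differ only in the phases of their centers. In the variable
  \<open>y = s * (\<xi> - \<eta>)\<close> the shift by \<open>20 * n * s\<close> becomes the
  exponential of \<open>integral_fourier_sq_cis\<close>, and since the transform of \<phi> is real,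
  the other factor is its square.\<close>

lemma packet_orthogonal_shift:
  assumes s: "s > 0" and c: "c = c' + 20 * of_int n * s" and n: "n \<noteq> 0"
  shows "(LINT x|lborel. packet \<phi> \<eta> c s x * cnj (packet \<phi> \<eta> c' s x)) = 0"
proof -
  have "fourier (packet \<phi> \<eta> c s) (\<eta> + 1 / s * y) * cnj (fourier (packet \<phi> \<eta> c' s) (\<eta> + 1 / s * y)) =
     of_real s * ((fourier \<phi> y)\<^sup>2 * cis (40 * pi * of_int (- n) * y))" for y
  proof -
    have "fourier (packet \<phi> \<eta> c s) (\<eta> + 1 / s * y) * cnj (fourier (packet \<phi> \<eta> c' s) (\<eta> + 1 / s * y)) =
      of_real (sqrt s * sqrt s) * (fourier \<phi> y)\<^sup>2 * (cis (- 2 * pi * c * (1 / s * y)) * cis (2 * pi * c' * (1 / s * y)))"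
      using s by (simp add: fourier_packet fourier_cnj cis_cnj power2_eq_square del: real_sqrt_mult_self)
    also have "cis (- 2 * pi * c * (1 / s * y)) * cis (2 * pi * c' * (1 / s * y)) = cis (40 * pi * of_int (- n) * y)"
      unfolding cis_mult c using s by (simp add: field_simps)
    finally show ?thesis
      using s by simp
  qed
  then have "(LINT \<xi>|lborel. fourier (packet \<phi> \<eta> c s) \<xi> * cnj (fourier (packet \<phi> \<eta> c' s) \<xi>)) =
     \<bar>1 / s\<bar> *\<^sub>R (LINT y|lborel. of_real s * ((fourier \<phi> y)\<^sup>2 * cis (40 * pi * of_int (- n) * y)))"
    using s by (subst lborel_integral_real_affine[of "1 / s" _ \<eta>]) simp_all
  also have "\<dots> = 0"
    using integral_fourier_sq_cis[of "- n"] n by simp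
  finally show ?thesis
    unfolding packet_parseval[OF s s] .
qed

section \<open>Decay of inner products at different scales\<close>

lemma integrable_packet_mult:
  assumes s: "s > 0" "s' > 0"
  shows "integrable lborel (\<lambda>x. packet \<phi> \<eta> c s x * cnj (packet \<phi> \<eta>' c' s' x))"
proof (rule Bochner_Integration.integrable_bound)
  show "integrable lborel (\<lambda>x. (s powr (- 1 / 2) * K) * norm (packet \<phi> \<eta>' c' s' x))"
    using integrable_packet[OF s(2)] by simp
  have [measurable]: "packet \<phi> \<eta> c s \<in> borel_measurable borel" "(\<lambda>x. cnj (packet \<phi> \<eta>' c' s' x)) \<in> borel_measurable borel"
    by (intro borel_measurable_continuous_onI continuous_intros continuous_packet s)+
  show "(\<lambda>x. packet \<phi> \<eta> c s x * cnj (packet \<phi> \<eta>' c' s' x)) \<in> borel_measurable lborel"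
    by measurable
  show "AE x in lborel. norm (packet \<phi> \<eta> c s x * cnj (packet \<phi> \<eta>' c' s' x)) \<le> norm ((s powr (- 1 / 2) * K) * norm (packet \<phi> \<eta>' c' s' x))"
    using norm_packet_le[OF s(1)] K by (intro AE_I2) (simp add: norm_mult abs_mult mult_right_mono)
qed

text \<open>Measured in the larger unit \<open>s\<close>, the offset of \<open>x\<close> from
  \<open>c'\<close> only shrinks, so \<open>bump a * bump b\<close> is controlled by the offset
  \<open>z\<close> of the centers. Two of the three powers in \<open>decay\<close> are used in this
  way, whence the factor 4; the third \<open>bump b\<close> integrates to \<open>s' * pi\<close>,
  and the normalizations turn \<open>s'\<close> into \<open>sqrt (s' / s)\<close>.\<close>

lemma packet_inner_le:
  assumes s: "0 < s'" "s' \<le> s"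
  shows "norm (LINT x|lborel. packet \<phi> \<eta> c s x * cnj (packet \<phi> \<eta>' c' s' x))
    \<le> 4 * pi * K\<^sup>2 * sqrt (s' / s) * (bump ((c' - c) / s))\<^sup>2"
proof -
  have s0: "s > 0" using s by simp
  define A where "A = s powr (- 1 / 2) * s' powr (- 1 / 2) * (4 * K\<^sup>2 * (bump ((c' - c) / s))\<^sup>2)"
  have pt: "norm (packet \<phi> \<eta> c s x * cnj (packet \<phi> \<eta>' c' s' x)) \<le> A * bump ((x - c') / s')" for x
  proof -
    define a b z where "a = (x - c) / s" and "b = (x - c') / s'" and "z = (c' - c) / s"
    have "\<bar>b * (s' / s)\<bar> = \<bar>b\<bar> * (s' / s)"
      using s s0 by (simp add: abs_mult)
    also have "\<dots> \<le> \<bar>b\<bar>"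
      using s s0 by (intro mult_left_le) auto
    finally have "bump a * bump b \<le> bump a * bump (- (b * (s' / s)))"
      by (intro mult_left_mono bump_mono) auto
    also have "\<dots> \<le> 2 * bump (a + - (b * (s' / s)))"
      by (rule bump_mult_le)
    also have "a + - (b * (s' / s)) = z"
      using s s0 by (simp add: a_def b_def z_def field_simps)
    finally have "(bump a * bump b)\<^sup>2 \<le> (2 * bump z)\<^sup>2"
      by (intro power_mono) auto
    then have 1: "bump a ^ 2 * bump b ^ 2 \<le> 4 * bump z ^ 2"
      by (simp add: power_mult_distrib)
    have "bump a ^ 3 * bump b ^ 3 = (bump a ^ 2 * bump b ^ 2) * (bump a * bump b)"
      by (simp add: power2_eq_square power3_eq_cube)
    also have "\<dots> \<le> (4 * bump z ^ 2) * (1 * bump b)"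
      by (intro mult_mono 1) auto
    finally have 2: "bump a ^ 3 * bump b ^ 3 \<le> 4 * bump z ^ 2 * bump b"
      by simp
    have "norm (\<phi> a) * norm (\<phi> b) \<le> (K * bump a ^ 3) * (K * bump b ^ 3)"
      using K by (intro mult_mono decay) auto
    also have "\<dots> = K\<^sup>2 * (bump a ^ 3 * bump b ^ 3)"
      by (simp add: power2_eq_square mult_ac)
    also have "\<dots> \<le> K\<^sup>2 * (4 * bump z ^ 2 * bump b)"
      by (intro mult_left_mono 2) simp
    finally have 3: "norm (\<phi> a) * norm (\<phi> b) \<le> K\<^sup>2 * (4 * bump z ^ 2 * bump b)" .
    have "norm (packet \<phi> \<eta> c s x * cnj (packet \<phi> \<eta>' c' s' x)) =
       s powr (- 1 / 2) * s' powr (- 1 / 2) * (norm (\<phi> a) * norm (\<phi> b))"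
      using s s0 by (simp add: norm_mult norm_packet a_def b_def)
    also have "\<dots> \<le> s powr (- 1 / 2) * s' powr (- 1 / 2) * (K\<^sup>2 * (4 * bump z ^ 2 * bump b))"
      by (intro mult_left_mono 3) simp
    finally show ?thesis
      by (simp add: A_def b_def z_def mult_ac)
  qed
  have int: "integrable lborel (\<lambda>x. A * bump ((x - c') / s'))"
    using integrable_rescale[OF s(1) integrable_bump] by simp
  have "norm (LINT x|lborel. packet \<phi> \<eta> c s x * cnj (packet \<phi> \<eta>' c' s' x)) \<le> (LINT x|lborel. A * bump ((x - c') / s'))"
    by (rule Bochner_Integration.integral_norm_bound_integral[OF integrable_packet_mult[OF s0 s(1)] int]) (rule pt)
  also have "\<dots> = A * (s' * pi)"
    using integral_rescale[OF s(1), of bump c'] by (simp add: integral_bump)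
  also have "\<dots> = (s powr (- 1 / 2) * (s' powr (- 1 / 2) * s')) * 4 * pi * K\<^sup>2 * (bump ((c' - c) / s))\<^sup>2"
    by (simp add: A_def)
  also have "s' powr (- 1 / 2) * s' = sqrt s'"
    using s powr_add[of s' "-1/2" 1] by (simp add: powr_half_sqrt)
  also have "s powr (- 1 / 2) * sqrt s' = sqrt (s' / s)"
    using s0 by (simp add: powr_minus_divide powr_half_sqrt real_sqrt_divide)
  finally show ?thesis
    by (simp add: mult_ac)
qed

end

section \<open>Trees of tiles\<close>

text \<open>A Riemann sum comparison: on an interval of length at most \<open>s\<close> the rescaled
  \<open>bump\<close> is comparable to its value at the midpoint, and the intervals are disjoint, so
  the sum is at most a multiple of the full integral \<open>pi * s\<close>.\<close>

lemma sum_bump_disjoint_le: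
  fixes c h :: "'i \<Rightarrow> real"
  assumes I: "finite I" and s: "s > 0"
    and h: "\<And>i. i \<in> I \<Longrightarrow> 0 < h i \<and> h i \<le> s"
    and disj: "disjoint_family_on (\<lambda>i. {c i - h i / 2 ..< c i + h i / 2}) I"
  shows "(\<Sum>i\<in>I. h i * bump ((c i - a) / s)) \<le> 5 / 2 * pi * s"
proof -
  define J where "J i = {c i - h i / 2 ..< c i + h i / 2}" for i
  have J: "(LINT y|lborel. indicator (J i) y * bump ((c i - a) / s)) = h i * bump ((c i - a) / s)"
    and Jint: "integrable lborel (\<lambda>y. indicator (J i) y * bump ((c i - a) / s))" if "i \<in> I" for i
    using h[OF that] unfolding J_def by simp_all
  have pt: "(\<Sum>i\<in>I. indicator (J i) y * bump ((c i - a) / s)) \<le> 5 / 2 * bump ((y - a) / s)" for y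
  proof (cases "\<exists>k\<in>I. y \<in> J k")
    case True
    then obtain k where k: "k \<in> I" "y \<in> J k" by blast
    have "indicator (J i) y * bump ((c i - a) / s) = 0" if "i \<in> I - {k}" for i
      using disj k that unfolding disjoint_family_on_def J_def[symmetric] by (auto simp: indicator_def)
    then have "(\<Sum>i\<in>I - {k}. indicator (J i) y * bump ((c i - a) / s)) = 0"
      by (intro sum.neutral) blast
    then have "(\<Sum>i\<in>I. indicator (J i) y * bump ((c i - a) / s)) = indicator (J k) y * bump ((c k - a) / s)"
      using sum.remove[OF I k(1), of "\<lambda>i. indicator (J i) y * bump ((c i - a) / s)"] by simp
    also have "\<dots> = bump ((c k - a) / s)"
      using k by simp
    also have "\<dots> \<le> 5 / 2 * bump ((y - a) / s)"
    proof -
      have "y - c k \<le> s / 2" "- (y - c k) \<le> s / 2"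
        using k(2) h[OF k(1)] unfolding J_def by auto
      then have "\<bar>y - c k\<bar> \<le> s / 2"
        by (rule abs_leI)
      then have "\<bar>(y - c k) / s\<bar> \<le> \<bar>1 / 2\<bar>"
        using s by (simp add: field_simps)
      then have "bump (1 / 2) \<le> bump ((y - c k) / s)"
        by (rule bump_mono)
      \<comment> \<open>\<open>bump (1 / 2)\<close> is 4/5; with the factor 2 of
        \<open>bump_mult_le\<close> the comparison constant becomes 5/2.\<close>
      then have "bump ((c k - a) / s) * (4 / 5) \<le> bump ((c k - a) / s) * bump ((y - c k) / s)"
        by (intro mult_left_mono) (auto simp: bump_def power2_eq_square)
      also have "\<dots> \<le> 2 * bump ((c k - a) / s + (y - c k) / s)"
        by (rule bump_mult_le)
      also have "(c k - a) / s + (y - c k) / s = (y - a) / s"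
        by (simp add: diff_divide_distrib)
      finally show ?thesis by simp
    qed
    finally show ?thesis .
  next
    case False
    then have "(\<Sum>i\<in>I. indicator (J i) y * bump ((c i - a) / s)) = 0"
      by (intro sum.neutral) auto
    then show ?thesis by simp
  qed
  have "(\<Sum>i\<in>I. h i * bump ((c i - a) / s)) = (\<Sum>i\<in>I. LINT y|lborel. indicator (J i) y * bump ((c i - a) / s))"
    by (intro sum.cong refl J[symmetric])
  also have "\<dots> = (LINT y|lborel. (\<Sum>i\<in>I. indicator (J i) y * bump ((c i - a) / s)))"
    by (intro Bochner_Integration.integral_sum[symmetric] Jint)
  also have "\<dots> \<le> (LINT y|lborel. 5 / 2 * bump ((y - a) / s))"
    using integrable_rescale[OF s integrable_bump]
    by (intro integral_mono pt Bochner_Integration.integrable_sum Jint) simp_all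
  also have "\<dots> = 5 / 2 * pi * s"
    using integral_rescale[OF s, of bump a] by (simp add: integral_bump)
  finally show ?thesis .
qed

section \<open>Geometry of tiles and tree intervals\<close>

abbreviation "width (P::tile) \<equiv> len (time_interval P)"
abbreviation "mid (P::tile) \<equiv> center (time_interval P)"
abbreviation "carrier_freq (P::tile) \<equiv> center (lower_half (freq_interval P))"

text \<open>The relation of the admissibility condition. Distinct tiles of the trees that it relates
  in neither direction have orthogonal packets (\<open>gram_eq_0\<close>).\<close>

definition under :: "tile \<Rightarrow> tile \<Rightarrow> bool"
  where "under P P' \<longleftrightarrow> freq_interval P \<subseteq> lower_half (freq_interval P')"

locale grids =
  fixes t t' r :: real
  assumes r: "r > 0"
begin

lemma r': "1 / r > 0"
  using r by simp

lemma
  assumes "P \<in> tiles t t' r"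
  shows tile_time: "time_interval P \<in> dyadic_grid t r"
    and tile_freq: "freq_interval P \<in> dyadic_grid t' (1 / r)"
    and width_pos: "width P > 0"
    and len_freq: "len (freq_interval P) = 1 / width P"
    and time_eq: "time_interval P = {mid P - width P / 2 ..< mid P + width P / 2}"
    and lower_half_eq: "lower_half (freq_interval P) = {carrier_freq P - 1 / (4 * width P) ..< carrier_freq P + 1 / (4 * width P)}"
    and mid_in: "mid P \<in> time_interval P"
proof -
  show 1: "time_interval P \<in> dyadic_grid t r" "freq_interval P \<in> dyadic_grid t' (1 / r)"
    using assms unfolding tiles_def by auto
  show 2: "width P > 0"
    using dyadic_nonempty[OF 1(1) r] by simp
  show 3: "len (freq_interval P) = 1 / width P"
    using assms 2 unfolding tiles_def by (simp add: field_simps)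
  show 4: "time_interval P = {mid P - width P / 2 ..< mid P + width P / 2}"
    by (rule dyadic_explicit(1)[OF 1(1) r])
  show "mid P \<in> time_interval P"
    by (subst 4) (use 2 in simp)
  show "lower_half (freq_interval P) = {carrier_freq P - 1 / (4 * width P) ..< carrier_freq P + 1 / (4 * width P)}"
  proof -
    have "carrier_freq P = center (freq_interval P) - 1 / (4 * width P)"
      using dyadic_explicit(3)[OF 1(2) r'] 3 by simp
    moreover have "lower_half (freq_interval P) = {center (freq_interval P) - 1 / (2 * width P) ..< center (freq_interval P)}"
      using dyadic_explicit(2)[OF 1(2) r'] 3 by (simp add: mult.commute)
    ultimately show ?thesis
      by (simp only:) simp
  qed
qed

lemma time_disjointI:
  assumes P: "P \<in> tiles t t' r" "P' \<in> tiles t t' r"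
    and far: "(width P + width P') / 2 \<le> \<bar>mid P - mid P'\<bar>"
  shows "time_interval P \<inter> time_interval P' = {}"
proof -
  have False if x: "x \<in> time_interval P" "x \<in> time_interval P'" for x
  proof -
    have "x \<in> {mid P - width P / 2 ..< mid P + width P / 2}"
      using x(1) time_eq[OF P(1)] by blast
    moreover have "x \<in> {mid P' - width P' / 2 ..< mid P' + width P' / 2}"
      using x(2) time_eq[OF P(2)] by blast
    ultimately show False
      using far by (auto simp: abs_if split: if_splits)
  qed
  then show ?thesis by blast
qed

text \<open>A lower half has radius \<open>1 / (4 * width P)\<close>, five times the support radius
  of the packet's transform. Disjoint lower halves keep their centers apart by the sum of the radii,
  which is more than required.\<close>

lemma freq_separated:
  assumes P: "P \<in> tiles t t' r" "P' \<in> tiles t t' r"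
    and disj: "lower_half (freq_interval P) \<inter> lower_half (freq_interval P') = {}"
  shows "\<bar>carrier_freq P - carrier_freq P'\<bar> > 1 / (20 * width P) + 1 / (20 * width P')"
proof -
  define x y where "x = 1 / (20 * width P)" and "y = 1 / (20 * width P')"
  have xy: "x > 0" "y > 0"
    using width_pos P by (simp_all add: x_def y_def)
  have "1 / (4 * width P) = 5 * x" "1 / (4 * width P') = 5 * y"
    by (simp_all add: x_def y_def)
  then have "{carrier_freq P - 5 * x ..< carrier_freq P + 5 * x} \<inter> {carrier_freq P' - 5 * y ..< carrier_freq P' + 5 * y} = {}"
    using disj lower_half_eq[OF P(1)] lower_half_eq[OF P(2)] by metis
  then have "max (carrier_freq P - 5 * x) (carrier_freq P' - 5 * y) \<ge> min (carrier_freq P + 5 * x) (carrier_freq P' + 5 * y)"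
    by (auto simp: disjoint_iff not_le[symmetric] dest: spec[of _ "max (carrier_freq P - 5 * x) (carrier_freq P' - 5 * y)"])
  then show ?thesis
    using xy unfolding x_def[symmetric] y_def[symmetric] by (auto simp: max_def min_def abs_if split: if_splits)
qed

lemma tile_freq_cases:
  assumes P: "P \<in> tiles t t' r" "P' \<in> tiles t t' r" and "freq_interval P \<noteq> freq_interval P'"
  shows "lower_half (freq_interval P) \<inter> lower_half (freq_interval P') = {} \<or> under P P' \<or> under P' P"
  unfolding under_def
  using dyadic_in_lower_half[OF tile_freq[OF P(1)] tile_freq[OF P(2)] r' _ assms(3)] by blast

text \<open>Tiles have area one, so a shorter frequency interval belongs to a longer time
  interval.\<close>

lemma under_width:
  assumes P: "P \<in> tiles t t' r" "P' \<in> tiles t t' r" and "under P P'"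
  shows "width P' \<le> width P"
proof -
  have "len (freq_interval P) \<le> len (lower_half (freq_interval P'))"
    using assms(3) dyadic_len_mono[OF tile_freq[OF P(1)] lower_half_dyadic(1)[OF tile_freq[OF P(2)] r'] r']
    unfolding under_def by blast
  also have "\<dots> \<le> 1 / width P'"
    using lower_half_dyadic(2)[OF tile_freq[OF P(2)] r'] len_freq[OF P(2)] width_pos[OF P(2)] by (simp add: field_simps)
  finally show ?thesis
    using len_freq[OF P(1)] width_pos[OF P(1)] width_pos[OF P(2)] by (simp add: field_simps)
qed

text \<open>Justifies the definite description: all top intervals contain the time interval of one
  tile of the tree, hence are nested in one another, and one with the fewest generations above that
  tile is the unique minimal one.\<close>

lemma tree_interval_top:
  assumes "is_tree t t' r \<T>"
  shows "tree_interval t t' r \<T> \<in> time_interval ` tops t t' r \<T>"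
proof -
  let ?I = "time_interval ` tops t t' r \<T>"
  obtain P where P: "P \<in> \<T>" "P \<in> tiles t t' r"
    using assms unfolding is_tree_def by blast
  have I: "J \<in> dyadic_grid t r \<and> time_interval P \<subseteq> J" if "J \<in> ?I" for J
    using that P tile_time unfolding tops_def tile_le_def by auto
  have nested: "J \<subseteq> J' \<or> J' \<subseteq> J" if "J \<in> ?I" "J' \<in> ?I" for J J'
  proof -
    have "J \<inter> J' \<noteq> {}"
      using I[OF that(1)] I[OF that(2)] mid_in[OF P(2)] by blast
    then show ?thesis
      using dyadic_linear I that r by blast
  qed
  obtain k0 where k0: "width P = 2 powi k0 * r"
    using dyadic_gridE[OF tile_time[OF P(2)] r] by metis
  \<comment> \<open>The number of dyadic generations between \<open>time_interval P\<close> and \<open>J\<close>.\<close>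
  define \<kappa> where "\<kappa> J = nat (\<lfloor>log 2 (len J / r)\<rfloor> - k0)" for J
  obtain J0 where J0: "J0 \<in> ?I"
    using assms unfolding is_tree_def by blast
  then obtain I0 where I0: "I0 \<in> ?I" "\<And>J. J \<in> ?I \<Longrightarrow> \<kappa> I0 \<le> \<kappa> J"
    using ex_has_least_nat[of "\<lambda>J. J \<in> ?I" J0 \<kappa>] by blast
  have len_ge: "\<exists>k. len J = 2 powi k * r \<and> k0 \<le> k \<and> \<kappa> J = nat (k - k0)" if J: "J \<in> ?I" for J
  proof -
    obtain k where k: "len J = 2 powi k * r"
      using dyadic_gridE[of J t r] I[OF J] r by metis
    have "width P \<le> len J"
      using dyadic_len_mono[OF tile_time[OF P(2)]] I[OF J] r by blast
    then have "(2::real) powi k0 \<le> 2 powi k"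
      using r unfolding k k0 by simp
    then have "k0 \<le> k"
      using power_int_strict_increasing[of k k0 "2::real"] by force
    moreover have "log 2 (len J / r) = of_int k"
      using r by (simp add: k powr_real_of_int'[symmetric])
    ultimately show ?thesis
      using k unfolding \<kappa>_def by auto
  qed
  have min: "J = I0" if J: "J \<in> ?I" "J \<subseteq> I0" for J
  proof -
    obtain k k' where "len J = 2 powi k * r" "k0 \<le> k" "\<kappa> J = nat (k - k0)"
      "len I0 = 2 powi k' * r" "k0 \<le> k'" "\<kappa> I0 = nat (k' - k0)"
      using len_ge[OF J(1)] len_ge[OF I0(1)] by blast
    then have "len I0 \<le> len J"
      using I0(2)[OF J(1)] r by (simp add: power_int_increasing)
    then have "I0 \<subseteq> J"
      using dyadic_nested[of I0 t r J] I[OF J(1)] I[OF I0(1)] r J(2) mid_in[OF P(2)] by blast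
    then show ?thesis using J by blast
  qed
  have "tree_interval t t' r \<T> = I0"
    unfolding tree_interval_def
  proof (rule the_equality)
    show "I0 \<in> ?I \<and> (\<forall>J\<in>?I. J \<subseteq> I0 \<longrightarrow> J = I0)"
      using I0(1) min by blast
    show "I' = I0" if "I' \<in> ?I \<and> (\<forall>J\<in>?I. J \<subseteq> I' \<longrightarrow> J = I')" for I'
      using that nested[of I' I0] I0(1) min by blast
  qed
  then show ?thesis
    using I0(1) by simp
qed

lemma tree_interval_facts:
  assumes T: "is_tree t t' r \<T>"
  shows "tree_interval t t' r \<T> \<in> dyadic_grid t r"
    and "\<And>P. P \<in> \<T> \<Longrightarrow> time_interval P \<subseteq> tree_interval t t' r \<T>"
    and "\<And>P. P \<in> \<T> \<Longrightarrow> width P \<le> len (tree_interval t t' r \<T>)"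
proof -
  show 1: "tree_interval t t' r \<T> \<in> dyadic_grid t r"
    using tree_interval_top[OF T] tile_time unfolding tops_def by auto
  show 2: "time_interval P \<subseteq> tree_interval t t' r \<T>" if "P \<in> \<T>" for P
    using tree_interval_top[OF T] that unfolding tops_def tile_le_def by auto
  show "width P \<le> len (tree_interval t t' r \<T>)" if "P \<in> \<T>" for P
  proof -
    have "P \<in> tiles t t' r"
      using T that unfolding is_tree_def by blast
    then show ?thesis
      using 2[OF that] dyadic_len_mono[OF tile_time 1 r] by blast
  qed
qed

text \<open>Both frequency intervals contain that of a top, so they meet, and meeting dyadic
  intervals of equal length coincide.\<close>

lemma tree_freq_eq:
  assumes T: "is_tree t t' r \<T>" and P: "P \<in> \<T>" "P' \<in> \<T>" and "width P = width P'"
  shows "freq_interval P = freq_interval P'"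
proof -
  have tP: "P \<in> tiles t t' r" "P' \<in> tiles t t' r"
    using T P unfolding is_tree_def by auto
  obtain T where T: "T \<in> tiles t t' r" "tile_le P T" "tile_le P' T"
    using T P unfolding is_tree_def tops_def by blast
  then have "freq_interval P \<inter> freq_interval P' \<noteq> {}"
    using dyadic_nonempty(1)[OF tile_freq[OF T(1)] r'] unfolding tile_le_def by blast
  moreover have "len (freq_interval P) = len (freq_interval P')"
    using len_freq tP assms(4) by simp
  ultimately show ?thesis
    using dyadic_nested[OF tile_freq[OF tP(1)] tile_freq[OF tP(2)] r']
      dyadic_nested[OF tile_freq[OF tP(2)] tile_freq[OF tP(1)] r'] by (metis inf_commute order_refl subset_antisym)
qed

end

section \<open>Disjointness and boundary weights in admissible collections\<close>

locale trees = grids +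
  fixes \<F> :: "tile set set"
  assumes admissible: "admissible_trees t t' r \<F>"
begin

lemma
  shows finite_tree: "\<T> \<in> \<F> \<Longrightarrow> finite \<T>"
    and tree: "\<T> \<in> \<F> \<Longrightarrow> is_tree t t' r \<T>"
    and disjoint_trees: "disjoint \<F>"
    and union_tiles: "P \<in> \<Union>\<F> \<Longrightarrow> P \<in> tiles t t' r"
    and finite_union: "finite (\<Union>\<F>)"
  using admissible unfolding admissible_trees_def is_tree_def by auto

text \<open>The standing convention in usable form. The shift is nonzero since the tiles differ, and
  a nonzero multiple of 20 widths moves a time interval off itself.\<close>

lemma same_freq:
  assumes P: "P \<in> \<Union>\<F>" "P' \<in> \<Union>\<F>" "P \<noteq> P'" "freq_interval P = freq_interval P'"
  obtains n :: int where "n \<noteq> 0" "width P = width P'" "mid P = mid P' + 20 * of_int n * width P"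
    "time_interval P \<inter> time_interval P' = {}"
proof -
  have "spaced (\<Union>\<F>)"
    using admissible unfolding admissible_trees_def by blast
  then obtain n :: int where n: "time_interval P = (\<lambda>x. x + 20 * of_int n * width P) ` time_interval P'"
    using P unfolding spaced_def by blast
  have tP: "P \<in> tiles t t' r" "P' \<in> tiles t t' r"
    using union_tiles P by auto
  have sc: "width P = width P'"
    using len_freq[OF tP(1)] len_freq[OF tP(2)] P(4) width_pos[OF tP(1)] width_pos[OF tP(2)] by simp
  have "n \<noteq> 0"
    using n P(3,4) by (auto simp: prod_eq_iff)
  have "{mid P - width P / 2 ..< mid P + width P / 2} =
     (\<lambda>x. x + 20 * of_int n * width P) ` {mid P' - width P / 2 ..< mid P' + width P / 2}"
    using n time_eq[OF tP(1)] time_eq[OF tP(2)] sc by metis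
  also have "\<dots> = {mid P' - width P / 2 + 20 * of_int n * width P ..< mid P' + width P / 2 + 20 * of_int n * width P}"
    by simp
  finally have mid: "mid P = mid P' + 20 * of_int n * width P"
    using width_pos[OF tP(1)] by (subst (asm) atLeastLessThan_eq_iff) auto
  define e where "e = 20 * of_int n * width P"
  have "mid P = mid P' + e"
    using mid by (simp add: e_def)
  have "real_of_int n \<ge> 1 \<or> real_of_int n \<le> -1"
    using \<open>n \<noteq> 0\<close> by linarith
  then have "e \<ge> width P \<or> e \<le> - width P"
    unfolding e_def using width_pos[OF tP(1)] mult_right_mono[of 1 "real_of_int n" "width P"]
      mult_right_mono[of "real_of_int n" "-1" "width P"] by auto
  then have "width P \<le> \<bar>e\<bar>"
    by auto
  then have "time_interval P \<inter> time_interval P' = {}"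
    using sc \<open>mid P = mid P' + e\<close> by (intro time_disjointI[OF tP]) simp
  with that[of n] \<open>n \<noteq> 0\<close> sc mid show ?thesis by blast
qed

lemma under_disjoint:
  assumes "\<T> \<in> \<F>" "P \<in> \<T>" "P' \<in> \<Union>\<F>" "under P P'"
  shows "time_interval P' \<inter> tree_interval t t' r \<T> = {}"
  using assms admissible unfolding admissible_trees_def under_def by blast

text \<open>Admissibility, with both tiles in the same tree, would put the time interval of
  \<open>P'\<close> outside the tree interval that contains it.\<close>

lemma tree_not_under:
  assumes "\<T> \<in> \<F>" "P \<in> \<T>" "P' \<in> \<T>"
  shows "\<not> under P P'"
proof
  assume "under P P'"
  then have "time_interval P' \<inter> tree_interval t t' r \<T> = {}"
    using under_disjoint assms by blast
  moreover have "mid P' \<in> time_interval P'" "time_interval P' \<subseteq> tree_interval t t' r \<T>"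
    using tree_interval_facts(2)[OF tree] mid_in union_tiles assms by blast+
  ultimately show False by blast
qed

lemma under_disjoint_pair:
  assumes P: "P' \<in> \<Union>\<F>" "P'' \<in> \<Union>\<F>" and ne: "P' \<noteq> P''" and u: "under P' P''"
  shows "time_interval P' \<inter> time_interval P'' = {}"
proof -
  obtain \<T> where T: "\<T> \<in> \<F>" "P' \<in> \<T>" using P by blast
  show ?thesis
    using under_disjoint[OF T P(2) u] tree_interval_facts(2)[OF tree[OF T(1)] T(2)] by blast
qed

text \<open>Both lower halves contain the frequency interval of \<open>P\<close>, so they meet.
  Either the frequency intervals are equal and the convention separates the tiles, or one tile is
  under the other and admissibility does.\<close>

lemma branch_disjoint:
  assumes P: "P \<in> \<Union>\<F>" "P' \<in> \<Union>\<F>" "P'' \<in> \<Union>\<F>" and ne: "P' \<noteq> P''"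
    and u: "under P P'" "under P P''"
  shows "time_interval P' \<inter> time_interval P'' = {}"
proof (cases "freq_interval P' = freq_interval P''")
  case True
  then show ?thesis
    using same_freq[OF P(2,3) ne] by metis
next
  case False
  have "freq_interval P \<noteq> {}"
    using dyadic_nonempty(1)[OF tile_freq r'] union_tiles P(1) by blast
  then have "lower_half (freq_interval P') \<inter> lower_half (freq_interval P'') \<noteq> {}"
    using u unfolding under_def by blast
  then have "under P' P'' \<or> under P'' P'"
    using tile_freq_cases[OF _ _ False] union_tiles P by blast
  then show ?thesis
    using under_disjoint_pair[of P' P''] under_disjoint_pair[of P'' P'] P ne by blast
qed

text \<open>For a tile of the tree, how far its center is from the complement of the tree interval,
  where every \<open>P'\<close> with \<open>under P P'\<close> is located. The weight below is the
  decay that this distance yields.\<close>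

definition edge_dist :: "tile set \<Rightarrow> tile \<Rightarrow> real"
  where "edge_dist \<T> P = min (mid P - Inf (tree_interval t t' r \<T>)) (Sup (tree_interval t t' r \<T>) - mid P)"

definition weight :: "tile set \<Rightarrow> tile \<Rightarrow> real"
  where "weight \<T> P = bump (edge_dist \<T> P / width P)"

lemma tree_interval_Inf_Sup:
  assumes "\<T> \<in> \<F>"
  shows "tree_interval t t' r \<T> = {Inf (tree_interval t t' r \<T>) ..< Sup (tree_interval t t' r \<T>)}"
proof -
  obtain a b where ab: "tree_interval t t' r \<T> = {a..<b}"
    using dyadic_explicit(1)[OF tree_interval_facts(1)[OF tree[OF assms]] r] by blast
  moreover have "tree_interval t t' r \<T> \<noteq> {}"
    using dyadic_nonempty(1)[OF tree_interval_facts(1)[OF tree[OF assms]] r] .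
  ultimately show ?thesis by auto
qed

lemma bump_under_le:
  assumes T: "\<T> \<in> \<F>" "P \<in> \<T>" and P': "P' \<in> \<Union>\<F>" and u: "under P P'"
  shows "bump ((mid P' - mid P) / width P) \<le> weight \<T> P"
proof -
  define a b where "a = Inf (tree_interval t t' r \<T>)" and "b = Sup (tree_interval t t' r \<T>)"
  have I: "tree_interval t t' r \<T> = {a..<b}"
    unfolding a_def b_def by (rule tree_interval_Inf_Sup[OF T(1)])
  have tP: "P \<in> tiles t t' r" "P' \<in> tiles t t' r"
    using union_tiles T P' by blast+
  have 1: "mid P \<in> {a..<b}"
    using mid_in[OF tP(1)] tree_interval_facts(2)[OF tree[OF T(1)] T(2)] I by blast
  have 2: "mid P' \<notin> {a..<b}"
    using mid_in[OF tP(2)] under_disjoint[OF T P' u] I by blast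
  have "0 \<le> edge_dist \<T> P" "edge_dist \<T> P \<le> \<bar>mid P' - mid P\<bar>"
    using 1 2 unfolding edge_dist_def a_def[symmetric] b_def[symmetric] by auto
  then show ?thesis
    unfolding weight_def using width_pos[OF tP(1)]
    by (intro bump_mono) (simp add: abs_divide divide_right_mono)
qed

text \<open>Tiles of equal width in a tree share their frequency interval and so are disjoint in
  time; at each of the two endpoints their terms sum to at most \<open>5 / 2 * pi\<close> times the
  width. The widths are dyadic, so they add up to at most twice the length of the tree
  interval.\<close>

lemma sum_weight_le:
  assumes T: "\<T> \<in> \<F>"
  shows "(\<Sum>P\<in>\<T>. width P * weight \<T> P) \<le> 10 * pi * len (tree_interval t t' r \<T>)"
proof -
  define a b where "a = Inf (tree_interval t t' r \<T>)" and "b = Sup (tree_interval t t' r \<T>)"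
  have fin: "finite \<T>"
    using finite_tree[OF T] .
  have tP: "P \<in> tiles t t' r" if "P \<in> \<T>" for P
    using union_tiles T that by blast
  have le: "width P * weight \<T> P \<le> width P * bump ((mid P - a) / width P) + width P * bump ((mid P - b) / width P)"
    if P: "P \<in> \<T>" for P
  proof -
    have "bump (- x) = bump x" for x
      by (simp add: bump_def)
    then have "bump ((b - mid P) / width P) = bump ((mid P - b) / width P)"
      by (metis minus_diff_eq minus_divide_left)
    then have "weight \<T> P \<le> bump ((mid P - a) / width P) + bump ((mid P - b) / width P)"
      unfolding weight_def edge_dist_def a_def[symmetric] b_def[symmetric] by (auto simp: min_def)
    then show ?thesis
      using width_pos[OF tP[OF P]] by (simp flip: distrib_left)
  qed
  have width_le: "(\<Sum>P\<in>{P\<in>\<T>. width P = \<sigma>}. width P * bump ((mid P - d) / width P)) \<le> 5 / 2 * pi * \<sigma>"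
    if "\<sigma> \<in> width ` \<T>" for \<sigma> d
  proof -
    have \<sigma>: "\<sigma> > 0"
      using that width_pos[OF tP] by blast
    have "(\<Sum>P\<in>{P\<in>\<T>. width P = \<sigma>}. width P * bump ((mid P - d) / width P)) =
       (\<Sum>P\<in>{P\<in>\<T>. width P = \<sigma>}. width P * bump ((mid P - d) / \<sigma>))"
      by (intro sum.cong) auto
    also have "\<dots> \<le> 5 / 2 * pi * \<sigma>"
    proof (rule sum_bump_disjoint_le[OF _ \<sigma>])
      show "finite {P \<in> \<T>. width P = \<sigma>}"
        using fin by simp
      show "0 < width P \<and> width P \<le> \<sigma>" if "P \<in> {P \<in> \<T>. width P = \<sigma>}" for P
        using that width_pos[OF tP[of P]] by simp
      show "disjoint_family_on (\<lambda>P. {mid P - width P / 2..<mid P + width P / 2}) {P \<in> \<T>. width P = \<sigma>}"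
        unfolding disjoint_family_on_def
      proof (intro ballI impI)
        fix P P' assume PP: "P \<in> {P \<in> \<T>. width P = \<sigma>}" "P' \<in> {P \<in> \<T>. width P = \<sigma>}" "P \<noteq> P'"
        then have "freq_interval P = freq_interval P'"
          using tree_freq_eq[OF tree[OF T]] by simp
        then have disj: "time_interval P \<inter> time_interval P' = {}"
          using same_freq[of P P'] PP T by blast
        have eq: "{mid Q - width Q / 2..<mid Q + width Q / 2} = time_interval Q" if "Q \<in> \<T>" for Q
          by (rule time_eq[symmetric]) (rule tP[OF that])
        show "{mid P - width P / 2..<mid P + width P / 2} \<inter> {mid P' - width P' / 2..<mid P' + width P' / 2} = {}"
          using PP(1,2) eq[of P] eq[of P'] disj by blast
      qed
    qed
    finally show ?thesis .
  qed
  have "(\<Sum>P\<in>\<T>. width P * weight \<T> P) \<le>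
     (\<Sum>P\<in>\<T>. width P * bump ((mid P - a) / width P) + width P * bump ((mid P - b) / width P))"
    by (intro sum_mono le)
  also have "\<dots> = (\<Sum>\<sigma>\<in>width ` \<T>. \<Sum>P\<in>{P\<in>\<T>. width P = \<sigma>}. width P * bump ((mid P - a) / width P) + width P * bump ((mid P - b) / width P))"
    by (rule sum.image_gen[OF fin])
  also have "\<dots> \<le> (\<Sum>\<sigma>\<in>width ` \<T>. 5 * pi * \<sigma>)"
  proof (intro sum_mono)
    fix \<sigma> assume "\<sigma> \<in> width ` \<T>"
    then show "(\<Sum>P\<in>{P\<in>\<T>. width P = \<sigma>}. width P * bump ((mid P - a) / width P) + width P * bump ((mid P - b) / width P)) \<le> 5 * pi * \<sigma>"
      using width_le[of \<sigma> a] width_le[of \<sigma> b] by (simp add: sum.distrib)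
  qed
  also have "\<dots> = 5 * pi * (\<Sum>\<sigma>\<in>width ` \<T>. \<sigma>)"
    by (simp add: sum_distrib_left)
  also have "(\<Sum>\<sigma>\<in>width ` \<T>. \<sigma>) \<le> 2 * len (tree_interval t t' r \<T>)"
  proof (rule dyadic_lens_sum)
    show "2 * x \<le> y" if xy: "x \<in> width ` \<T>" "y \<in> width ` \<T>" "x < y" for x y
      using xy dyadic_len_cases[OF tile_time[OF tP] tile_time[OF tP] r] by auto
  qed (use fin tP width_pos tree_interval_facts(3)[OF tree[OF T]] in auto)
  finally show ?thesis
    by simp
qed

text \<open>Unique on the union because the trees are disjoint; it selects the tree whose boundary
  the weight of a tile refers to.\<close>

definition tree_of :: "tile \<Rightarrow> tile set"
  where "tree_of P = (THE \<T>. \<T> \<in> \<F> \<and> P \<in> \<T>)"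

lemma tree_of_eq: "\<T> \<in> \<F> \<Longrightarrow> P \<in> \<T> \<Longrightarrow> tree_of P = \<T>"
  unfolding tree_of_def using disjoint_trees by (intro the_equality) (auto simp: disjoint_def)

lemma tree_of: "P \<in> \<Union>\<F> \<Longrightarrow> tree_of P \<in> \<F>" "P \<in> \<Union>\<F> \<Longrightarrow> P \<in> tree_of P"
  using tree_of_eq by (metis UnionE)+

lemma sum_trees:
  fixes F :: "tile \<Rightarrow> real"
  shows "(\<Sum>P\<in>\<Union>\<F>. F P) = (\<Sum>\<T>\<in>\<F>. \<Sum>P\<in>\<T>. F P)"
  using sum.Union_disjoint[of \<F> F] finite_tree disjoint_trees by (simp add: disjoint_def)

lemma sum_weight_union_le:
  "(\<Sum>P\<in>\<Union>\<F>. width P * weight (tree_of P) P) \<le> 10 * pi * (\<Sum>\<T>\<in>\<F>. len (tree_interval t t' r \<T>))"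
proof -
  have "(\<Sum>P\<in>\<Union>\<F>. width P * weight (tree_of P) P) = (\<Sum>\<T>\<in>\<F>. \<Sum>P\<in>\<T>. width P * weight \<T> P)"
    unfolding sum_trees by (intro sum.cong refl) (simp add: tree_of_eq)
  also have "\<dots> \<le> (\<Sum>\<T>\<in>\<F>. 10 * pi * len (tree_interval t t' r \<T>))"
    by (intro sum_mono sum_weight_le)
  finally show ?thesis
    by (simp add: sum_distrib_left)
qed

end

section \<open>Almost orthogonality\<close>

locale packets = trees t t' r \<F> + profile \<phi> K
  for t t' r :: real and \<F> :: "tile set set" and \<phi> :: "real \<Rightarrow> complex" and K :: real
begin

definition gram :: "tile \<Rightarrow> tile \<Rightarrow> complex"
  where "gram P P' = (LINT x|lborel. wave_packet \<phi> P x * cnj (wave_packet \<phi> P' x))"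

lemma gram_cnj: "gram P' P = cnj (gram P P')"
  unfolding gram_def by (simp add: mult.commute flip: Bochner_Integration.integral_cnj)

lemma gram_self: "P \<in> \<Union>\<F> \<Longrightarrow> gram P P = of_real (LINT x|lborel. (norm (\<phi> x))\<^sup>2)"
  unfolding gram_def wave_packet_eq_packet by (rule packet_norm_sq[OF width_pos[OF union_tiles]])

text \<open>For equal frequency intervals, the convention makes the tiles shifts of each other by
  the right multiple. For different ones, the lower halves are disjoint since neither tile is under
  the other, so the frequency supports separate.\<close>

lemma gram_eq_0:
  assumes P: "P \<in> \<Union>\<F>" "P' \<in> \<Union>\<F>" "P \<noteq> P'" and u: "\<not> under P P'" "\<not> under P' P"
  shows "gram P P' = 0"
proof (cases "freq_interval P = freq_interval P'")
  case True
  obtain n :: int where n: "n \<noteq> 0" "width P = width P'" "mid P = mid P' + 20 * of_int n * width P"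
    using same_freq[OF P True] by metis
  have "mid P = mid P' + 20 * of_int n * width P'"
    using n(2,3) by simp
  then show ?thesis
    unfolding gram_def wave_packet_eq_packet True n(2)
    by (rule packet_orthogonal_shift[OF width_pos[OF union_tiles[OF P(2)]]]) (rule n(1))
next
  case False
  have tP: "P \<in> tiles t t' r" "P' \<in> tiles t t' r"
    using union_tiles P by blast+
  have "lower_half (freq_interval P) \<inter> lower_half (freq_interval P') = {}"
    using tile_freq_cases[OF tP False] u by blast
  from freq_separated[OF tP this] show ?thesis
    unfolding gram_def wave_packet_eq_packet
    by (rule packet_orthogonal_freq[OF width_pos[OF tP(1)] width_pos[OF tP(2)]])
qed

lemma gram_under_le:
  assumes P: "P \<in> \<Union>\<F>" "P' \<in> \<Union>\<F>" and u: "under P P'"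
  shows "norm (gram P P') \<le> 4 * pi * K\<^sup>2 * sqrt (width P' / width P) * (bump ((mid P' - mid P) / width P))\<^sup>2"
  unfolding gram_def wave_packet_eq_packet using P u union_tiles
  by (intro packet_inner_le width_pos under_width) auto

text \<open>A row of the Gram matrix. The size bound supplies one \<open>sqrt (width P')\<close> and
  the Gram bound another, which makes the \<open>width P'\<close> needed for
  \<open>sum_bump_disjoint_le\<close>. The tiles \<open>P'\<close> are disjoint in time by
  \<open>branch_disjoint\<close> and no wider than \<open>P\<close>; the constant is
  \<open>4 * pi\<close> times \<open>5 / 2 * pi\<close>.\<close>

lemma gram_sum_le:
  assumes Q: "Q \<subseteq> \<Union>\<F>" and P: "P \<in> Q"
    and A: "A \<ge> 0" and size: "\<And>P. P \<in> Q \<Longrightarrow> \<alpha> P \<le> A * sqrt (width P)"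
  shows "(\<Sum>P'\<in>{P'\<in>Q. under P P'}. \<alpha> P' * norm (gram P P')) \<le> 10 * pi\<^sup>2 * K\<^sup>2 * A * (sqrt (width P) * weight (tree_of P) P)"
proof -
  have fin: "finite Q"
    using finite_subset[OF Q finite_union] .
  have PU: "P \<in> \<Union>\<F>"
    using P Q by blast
  have w: "width P > 0"
    using width_pos union_tiles PU by blast
  define C where "C = 4 * pi * K\<^sup>2 * A * weight (tree_of P) P / sqrt (width P)"
  have W0: "weight (tree_of P) P \<ge> 0"
    by (simp add: weight_def)
  have C: "C \<ge> 0"
    using A w W0 by (simp add: C_def)
  have "\<alpha> P' * norm (gram P P') \<le> C * (width P' * bump ((mid P' - mid P) / width P))"
    if P': "P' \<in> {P'\<in>Q. under P P'}" for P'
  proof -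
    have P'U: "P' \<in> \<Union>\<F>" and u: "under P P'" and P'Q: "P' \<in> Q"
      using P' Q by auto
    have w': "width P' > 0"
      using width_pos union_tiles P'U by blast
    define b where "b = bump ((mid P' - mid P) / width P)"
    have b: "b \<le> weight (tree_of P) P" "b \<ge> 0"
      unfolding b_def using bump_under_le[OF tree_of[OF PU] P'U u] by auto
    have "\<alpha> P' * norm (gram P P') \<le> (A * sqrt (width P')) * (4 * pi * K\<^sup>2 * sqrt (width P' / width P) * b\<^sup>2)"
      unfolding b_def using A w' by (intro mult_mono size P'Q gram_under_le PU P'U u) auto
    also have "\<dots> = 4 * pi * K\<^sup>2 * A * (sqrt (width P') * sqrt (width P')) / sqrt (width P) * b * b"
      by (simp add: real_sqrt_divide power2_eq_square)
    also have "\<dots> = 4 * pi * K\<^sup>2 * A * width P' / sqrt (width P) * b * b"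
      using w' by simp
    also have "\<dots> \<le> 4 * pi * K\<^sup>2 * A * width P' / sqrt (width P) * weight (tree_of P) P * b"
      using b A w w' by (intro mult_right_mono mult_left_mono) auto
    also have "\<dots> = C * (width P' * b)"
      by (simp add: C_def)
    finally show ?thesis
      unfolding b_def .
  qed
  \<comment> \<open>One bump factor has been spent on the weight; the other one makes the sum over the disjoint
    time intervals converge.\<close>
  then have "(\<Sum>P'\<in>{P'\<in>Q. under P P'}. \<alpha> P' * norm (gram P P')) \<le>
      C * (\<Sum>P'\<in>{P'\<in>Q. under P P'}. width P' * bump ((mid P' - mid P) / width P))"
    unfolding sum_distrib_left by (rule sum_mono)
  also have "\<dots> \<le> C * (5 / 2 * pi * width P)"
  proof (intro mult_left_mono C sum_bump_disjoint_le w)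
    show "finite {P' \<in> Q. under P P'}"
      using fin by simp
    show "0 < width P' \<and> width P' \<le> width P" if "P' \<in> {P' \<in> Q. under P P'}" for P'
      using that Q PU union_tiles width_pos under_width by blast
    show "disjoint_family_on (\<lambda>P'. {mid P' - width P' / 2..<mid P' + width P' / 2}) {P' \<in> Q. under P P'}"
      unfolding disjoint_family_on_def
    proof (intro ballI impI)
      fix P1 P2 assume PP: "P1 \<in> {P' \<in> Q. under P P'}" "P2 \<in> {P' \<in> Q. under P P'}" "P1 \<noteq> P2"
      then have U: "P1 \<in> \<Union>\<F>" "P2 \<in> \<Union>\<F>"
        using Q by auto
      then have "time_interval P1 \<inter> time_interval P2 = {}"
        using branch_disjoint[OF PU] PP by blast
      then show "{mid P1 - width P1 / 2..<mid P1 + width P1 / 2} \<inter> {mid P2 - width P2 / 2..<mid P2 + width P2 / 2} = {}"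
        using time_eq[OF union_tiles[OF U(1)]] time_eq[OF union_tiles[OF U(2)]] by blast
    qed
  qed
  also have "\<dots> = 10 * pi\<^sup>2 * K\<^sup>2 * A * (width P / sqrt (width P) * weight (tree_of P) P)"
    by (simp add: C_def power2_eq_square)
  also have "width P / sqrt (width P) = sqrt (width P)"
    using w by (simp add: real_div_sqrt)
  finally show ?thesis .
qed

section \<open>Square norms of packet expansions\<close>

context
  fixes a :: "tile \<Rightarrow> 'h::complex_hilbert"
begin

definition synth :: "tile set \<Rightarrow> real \<Rightarrow> 'h"
  where "synth Q x = (\<Sum>P\<in>Q. wave_packet \<phi> P x *\<^sub>C a P)"

text \<open>The squared norm expands into a finite sum of products of two packets, integrable over
  \<open>lborel\<close>; passing to the completion gives the statements over
  \<open>lebesgue\<close>.\<close>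

lemma
  assumes Q: "Q \<subseteq> \<Union>\<F>"
  shows integrable_synth: "integrable lebesgue (\<lambda>x. (norm (synth Q x))\<^sup>2)"
    and integral_synth: "(LINT x|lebesgue. (norm (synth Q x))\<^sup>2) = Re (\<Sum>P\<in>Q. \<Sum>P'\<in>Q. gram P P' * cinner (a P) (a P'))"
    and measurable_synth: "(\<lambda>x. norm (synth Q x)) \<in> borel_measurable lebesgue"
proof -
  define h where "h x = (\<Sum>P\<in>Q. \<Sum>P'\<in>Q. (wave_packet \<phi> P x * cnj (wave_packet \<phi> P' x)) * cinner (a P) (a P'))" for x
  have term_int: "integrable lborel (\<lambda>x. (wave_packet \<phi> P x * cnj (wave_packet \<phi> P' x)) * cinner (a P) (a P'))"
    if "P \<in> Q" "P' \<in> Q" for P P'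
    unfolding wave_packet_eq_packet
    by (intro integrable_mult_left integrable_packet_mult width_pos union_tiles) (use that Q in auto)
  have "integrable lborel h"
    unfolding h_def by (intro Bochner_Integration.integrable_sum term_int)
  then have hR: "integrable lborel (\<lambda>x. Re (h x))"
    by (rule integrable_Re)
  have eq: "(norm (synth Q x))\<^sup>2 = Re (h x)" for x
    unfolding synth_def h_def norm_sum_scaleC_sq by simp
  have m [measurable]: "(\<lambda>x. Re (h x)) \<in> borel_measurable lborel"
    using borel_measurable_integrable[OF hR] .
  show I: "integrable lebesgue (\<lambda>x. (norm (synth Q x))\<^sup>2)"
    unfolding eq using hR integrable_completion[of "\<lambda>x. Re (h x)" lborel] by simp
  have "(LINT x|lebesgue. (norm (synth Q x))\<^sup>2) = (LINT x|lborel. Re (h x))"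
    unfolding eq using integral_completion[of "\<lambda>x. Re (h x)" lborel] by simp
  also have "\<dots> = Re (LINT x|lborel. h x)"
    by (rule integral_Re[OF \<open>integrable lborel h\<close>])
  also have "(LINT x|lborel. h x) = (\<Sum>P\<in>Q. \<Sum>P'\<in>Q. gram P P' * cinner (a P) (a P'))"
    unfolding h_def
    by (subst Bochner_Integration.integral_sum, intro Bochner_Integration.integrable_sum term_int, assumption+,
        intro sum.cong refl, subst Bochner_Integration.integral_sum, intro term_int, assumption+)
      (simp add: gram_def)
  finally show "(LINT x|lebesgue. (norm (synth Q x))\<^sup>2) = Re (\<Sum>P\<in>Q. \<Sum>P'\<in>Q. gram P P' * cinner (a P) (a P'))" .
  have "(\<lambda>x. sqrt ((norm (synth Q x))\<^sup>2)) \<in> borel_measurable lebesgue"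
    using borel_measurable_integrable[OF I] by measurable
  then show "(\<lambda>x. norm (synth Q x)) \<in> borel_measurable lebesgue"
    by simp
qed

text \<open>No tile of a tree is under another, so all off-diagonal Gram entries vanish.\<close>

lemma integral_synth_tree:
  assumes T: "\<T> \<in> \<F>"
  shows "(LINT x|lebesgue. (norm (synth \<T> x))\<^sup>2) = (LINT x|lborel. (norm (\<phi> x))\<^sup>2) * (\<Sum>P\<in>\<T>. (norm (a P))\<^sup>2)"
proof -
  have "(\<Sum>P'\<in>\<T>. gram P P' * cinner (a P) (a P')) = of_real ((LINT x|lborel. (norm (\<phi> x))\<^sup>2) * (norm (a P))\<^sup>2)"
    if P: "P \<in> \<T>" for P
  proof -
    have "(\<Sum>P'\<in>\<T> - {P}. gram P P' * cinner (a P) (a P')) = 0"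
    proof (rule sum.neutral, intro ballI)
      fix P' assume P': "P' \<in> \<T> - {P}"
      have "gram P P' = 0"
        by (rule gram_eq_0) (use P P' T tree_not_under in auto)
      then show "gram P P' * cinner (a P) (a P') = 0" by simp
    qed
    then show ?thesis
      using sum.remove[OF finite_tree[OF T] P, of "\<lambda>P'. gram P P' * cinner (a P) (a P')"] gram_self[of P] P T
      by (auto simp: cinner_self)
  qed
  then have "(\<Sum>P\<in>\<T>. \<Sum>P'\<in>\<T>. gram P P' * cinner (a P) (a P')) =
     of_real (\<Sum>P\<in>\<T>. (LINT x|lborel. (norm (\<phi> x))\<^sup>2) * (norm (a P))\<^sup>2)"
    by simp
  then show ?thesis
    using integral_synth[of \<T>] T by (auto simp: sum_distrib_left)
qed

text \<open>The bounds for the off-diagonal terms are symmetric in the two tiles and vanish unless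
  one is under the other, so it suffices to sum over \<open>under P P'\<close> and double.\<close>

lemma integral_synth_le:
  assumes Q: "Q \<subseteq> \<Union>\<F>"
  shows "(LINT x|lebesgue. (norm (synth Q x))\<^sup>2) \<le> (LINT x|lborel. (norm (\<phi> x))\<^sup>2) * (\<Sum>P\<in>Q. (norm (a P))\<^sup>2)
     + 2 * (\<Sum>P\<in>Q. norm (a P) * (\<Sum>P'\<in>{P'\<in>Q. under P P'}. norm (a P') * norm (gram P P')))"
proof -
  have fin: "finite Q"
    using finite_subset[OF Q finite_union] .
  define \<kappa> where "\<kappa> = (LINT x|lborel. (norm (\<phi> x))\<^sup>2)"
  define m where "m P P' = norm (a P) * (norm (a P') * norm (gram P P'))" for P P'
  have msym: "m P P' = m P' P" for P P'
    using gram_cnj[of P P'] by (simp add: m_def mult_ac)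
  have m0: "m P P' \<ge> 0" for P P'
    by (simp add: m_def)
  \<comment> \<open>All three summands are nonnegative, so it does no harm if several conditions
    hold at once.\<close>
  have le: "Re (gram P P' * cinner (a P) (a P')) \<le>
     (if P = P' then \<kappa> * (norm (a P))\<^sup>2 else 0) + (if under P P' then m P P' else 0) + (if under P' P then m P P' else 0)"
    if P: "P \<in> Q" "P' \<in> Q" for P P'
  proof -
    have "Re (gram P P' * cinner (a P) (a P')) \<le> norm (gram P P') * norm (cinner (a P) (a P'))"
      by (metis complex_Re_le_cmod norm_mult)
    also have "\<dots> \<le> norm (gram P P') * (norm (a P) * norm (a P'))"
      by (intro mult_left_mono cinner_Cauchy_Schwarz) simp
    finally have 1: "Re (gram P P' * cinner (a P) (a P')) \<le> m P P'"
      by (simp add: m_def mult_ac)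
    show ?thesis
    proof (cases "P = P'")
      case True
      have "Re (gram P P' * cinner (a P) (a P')) = \<kappa> * (norm (a P))\<^sup>2"
      proof -
        have "gram P P = of_real \<kappa>"
          unfolding \<kappa>_def by (rule gram_self) (use P Q in blast)
        then show ?thesis
          using True by (simp add: cinner_self)
      qed
      then show ?thesis
        using True m0 by simp
    next
      case False
      show ?thesis
      proof (cases "under P P' \<or> under P' P")
        case True
        then show ?thesis
          using 1 m0[of P P'] False by auto
      next
        case nu: False
        then have "gram P P' = 0"
          using gram_eq_0[of P P'] False P Q by blast
        then show ?thesis
          using False nu by simp
      qed
    qed
  qed
  have restrict: "(\<Sum>P'\<in>Q. if R P' then F P' else 0) = (\<Sum>P'\<in>{P'\<in>Q. R P'}. F P')" for R and F :: "tile \<Rightarrow> real"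
    using sum.inter_filter[OF fin, of F R] by simp
  have "(LINT x|lebesgue. (norm (synth Q x))\<^sup>2) = (\<Sum>P\<in>Q. \<Sum>P'\<in>Q. Re (gram P P' * cinner (a P) (a P')))"
    unfolding integral_synth[OF Q] by simp
  also have "\<dots> \<le> (\<Sum>P\<in>Q. \<Sum>P'\<in>Q. (if P = P' then \<kappa> * (norm (a P))\<^sup>2 else 0) + (if under P P' then m P P' else 0) + (if under P' P then m P P' else 0))"
    by (intro sum_mono le)
  also have "\<dots> = (\<Sum>P\<in>Q. \<kappa> * (norm (a P))\<^sup>2) + (\<Sum>P\<in>Q. \<Sum>P'\<in>Q. if under P P' then m P P' else 0) + (\<Sum>P\<in>Q. \<Sum>P'\<in>Q. if under P' P then m P P' else 0)"
    by (simp add: sum.distrib fin)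
  also have "(\<Sum>P\<in>Q. \<Sum>P'\<in>Q. if under P' P then m P P' else 0) = (\<Sum>P\<in>Q. \<Sum>P'\<in>Q. if under P P' then m P P' else 0)"
    by (subst sum.swap) (simp add: msym cong: if_cong)
  also have "(\<Sum>P\<in>Q. \<Sum>P'\<in>Q. if under P P' then m P P' else 0) =
      (\<Sum>P\<in>Q. norm (a P) * (\<Sum>P'\<in>{P'\<in>Q. under P P'}. norm (a P') * norm (gram P P')))"
    unfolding restrict by (simp add: m_def sum_distrib_left)
  finally show ?thesis
    by (simp add: \<kappa>_def sum_distrib_left)
qed

end

end

section \<open>Logarithmic energy bound\<close>

lemma Lq_norm_2: "Lq_norm 2 f = sqrt (LINT x|lebesgue. (norm (f x))\<^sup>2)"
  unfolding Lq_norm_def by (simp add: powr_half_sqrt)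

lemma Lq_norm_2_sq: "(Lq_norm 2 f)\<^sup>2 = (LINT x|lebesgue. (norm (f x))\<^sup>2)"
  unfolding Lq_norm_2 by simp

lemma Lq_space_2:
  assumes "f \<in> Lq_space 2"
  shows "integrable lebesgue (\<lambda>x. (norm (f x))\<^sup>2)" "(\<lambda>x. norm (f x)) \<in> borel_measurable lebesgue"
proof -
  show 1: "integrable lebesgue (\<lambda>x. (norm (f x))\<^sup>2)"
    using assms unfolding Lq_space_def by simp
  have "(\<lambda>x. sqrt ((norm (f x))\<^sup>2)) \<in> borel_measurable lebesgue"
    using borel_measurable_integrable[OF 1] by measurable
  then show "(\<lambda>x. norm (f x)) \<in> borel_measurable lebesgue"
    by simp
qed

text \<open>The essential supremum is an extended real. A negative value would put
  \<open>norm (f x)\<close> below zero almost everywhere on a space of positive measure; so it is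
  finite and nonnegative, and \<open>real_of_ereal\<close> loses nothing.\<close>

lemma
  assumes "f \<in> Linf_space"
  shows AE_Linf_norm: "AE x in lebesgue. norm (f x) \<le> Linf_norm f"
    and Linf_norm_nonneg: "Linf_norm f \<ge> 0"
proof -
  define e where "e = esssup lebesgue (\<lambda>x. ereal (norm (f x)))"
  have fin: "e < \<infinity>"
    using assms unfolding Linf_space_def e_def by simp
  have AE: "AE x in lebesgue. ereal (norm (f x)) \<le> e"
    unfolding e_def by (rule esssup_AE)
  have "e \<ge> 0"
  proof (rule ccontr)
    assume "\<not> e \<ge> 0"
    have "AE x::real in lebesgue. False"
    proof (rule eventually_mono[OF AE])
      fix x
      assume le: "ereal (norm (f x)) \<le> e"
      have "0 \<le> ereal (norm (f x))"
        by simp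
      from order_trans[OF this le] show False
        using \<open>\<not> e \<ge> 0\<close> by contradiction
    qed
    then have "emeasure lebesgue (UNIV :: real set) = 0"
      by (simp add: AE_iff_measurable[of UNIV])
    then show False
      by simp
  qed
  then have e: "e = ereal (Linf_norm f)"
    using fin unfolding Linf_norm_def e_def[symmetric] by (cases e) auto
  show "Linf_norm f \<ge> 0"
    using \<open>e \<ge> 0\<close> e by simp
  show "AE x in lebesgue. norm (f x) \<le> Linf_norm f"
    using AE e by simp
qed

context profile
begin

definition "mass = (LINT x|lborel. (norm (\<phi> x))\<^sup>2)"
definition "L1_norm = (LINT x|lborel. norm (\<phi> x))"
definition "cross_const = 10 * pi\<^sup>2 * K\<^sup>2"
text \<open>Dominates the constants of all cases below: 1 if the energy is already at most the
  squared norm, \<open>mass + 4 * cross_const\<close> for comparable coefficients,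
  \<open>mass + 2 * cross_const * sqrt (10 * pi)\<close> for small ones.\<close>

definition "level_const = 1 + mass + 4 * cross_const + 2 * cross_const * sqrt (10 * pi)"

lemma const_nonneg: "mass \<ge> 0" "L1_norm \<ge> 0" "cross_const \<ge> 0" "level_const \<ge> 1"
  by (simp_all add: mass_def L1_norm_def cross_const_def level_const_def)

end

section \<open>Energy estimates for a fixed function\<close>

locale tile_setting = packets t t' r \<F> \<phi> K
  for t t' r :: real and \<F> :: "tile set set" and \<phi> :: "real \<Rightarrow> complex" and K :: real +
  fixes f :: "real \<Rightarrow> 'h::complex_hilbert"
  assumes f2: "f \<in> Lq_space 2" and finf: "f \<in> Linf_space"
begin

abbreviation "coef \<equiv> coefficient \<phi> f"

abbreviation "top_length \<equiv> (\<Sum>\<T>\<in>\<F>. len (tree_interval t t' r \<T>))"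

definition "energy Q = (\<Sum>P\<in>Q. (norm (coef P))\<^sup>2)"

lemma energy_nonneg: "energy Q \<ge> 0"
  unfolding energy_def by (simp add: sum_nonneg)

lemma L2_nonneg: "Lq_norm 2 f \<ge> 0"
  by (simp add: Lq_norm_2)

text \<open>Hoelder with the integral norm of the packet, which scales like
  \<open>sqrt (width P)\<close>. This is the initial size bound for the halving.\<close>

lemma norm_coef_le:
  assumes P: "P \<in> \<Union>\<F>"
  shows "norm (coef P) \<le> L1_norm * Linf_norm f * sqrt (width P)"
proof (cases "(\<lambda>x. cnj (wave_packet \<phi> P x) *\<^sub>C f x) integrable_on UNIV")
  case True
  have w: "width P > 0"
    using width_pos union_tiles P by blast
  note pk = wave_packet_eq_packet[of \<phi> P]
  have int: "integrable lebesgue (\<lambda>x. norm (wave_packet \<phi> P x))"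
    using integrable_packet[OF w] packet_measurable[OF w] integrable_completion[of "\<lambda>x. norm (wave_packet \<phi> P x)" lborel]
    unfolding pk by simp
  have [measurable]: "(\<lambda>x. norm (wave_packet \<phi> P x)) \<in> borel_measurable lebesgue"
    using borel_measurable_integrable[OF int] .
  have [measurable]: "(\<lambda>x. norm (f x)) \<in> borel_measurable lebesgue"
    by (rule Lq_space_2(2)[OF f2])
  have AE: "AE x in lebesgue. norm (wave_packet \<phi> P x) * norm (f x) \<le> norm (wave_packet \<phi> P x) * Linf_norm f"
    using AE_Linf_norm[OF finf] by eventually_elim (simp add: mult_left_mono)
  have intr: "integrable lebesgue (\<lambda>x. norm (wave_packet \<phi> P x) * Linf_norm f)"
    using int by simp
  have int2: "integrable lebesgue (\<lambda>x. norm (wave_packet \<phi> P x) * norm (f x))"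
  proof (rule Bochner_Integration.integrable_bound[OF intr])
    show "AE x in lebesgue. norm (norm (wave_packet \<phi> P x) * norm (f x)) \<le> norm (norm (wave_packet \<phi> P x) * Linf_norm f)"
      using AE Linf_norm_nonneg[OF finf] by simp
  qed measurable
  have "norm (coef P) \<le> integral UNIV (\<lambda>x. norm (wave_packet \<phi> P x) * norm (f x))"
    unfolding coefficient_def
    by (rule integral_norm_bound_integral[OF True integrable_on_lebesgue[OF int2]]) (simp add: norm_scaleC)
  also have "\<dots> = (LINT x|lebesgue. norm (wave_packet \<phi> P x) * norm (f x))"
    by (rule integral_lebesgue[OF int2])
  also have "\<dots> \<le> (LINT x|lebesgue. norm (wave_packet \<phi> P x) * Linf_norm f)"
    by (rule integral_mono_AE[OF int2 intr AE])
  also have "\<dots> = (LINT x|lebesgue. norm (wave_packet \<phi> P x)) * Linf_norm f"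
    by simp
  also have "(LINT x|lebesgue. norm (wave_packet \<phi> P x)) = (LINT x|lborel. norm (wave_packet \<phi> P x))"
    by (rule integral_completion) (use packet_measurable[OF w] in \<open>simp add: pk\<close>)
  also have "\<dots> = sqrt (width P) * L1_norm"
    unfolding pk L1_norm_def by (rule integral_norm_packet[OF w])
  finally show ?thesis
    by (simp add: mult_ac)
next
  case False
  \<comment> \<open>The gauge integral has the default value 0 when it does not exist.\<close>
  then have "coef P = 0"
    unfolding coefficient_def by (rule not_integrable_integral)
  then show ?thesis
    using const_nonneg Linf_norm_nonneg[OF finf] by simp
qed

lemma energy_sq_le:
  assumes Q: "Q \<subseteq> \<Union>\<F>"
  shows "(energy Q)\<^sup>2 \<le> (Lq_norm 2 f)\<^sup>2 * (LINT x|lebesgue. (norm (synth coef Q x))\<^sup>2)"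
proof -
  have fin: "finite Q"
    using finite_subset[OF Q finite_union] .
  have "energy Q \<le> Lq_norm 2 f * sqrt (LINT x|lebesgue. (norm (synth coef Q x))\<^sup>2)"
    unfolding energy_def Lq_norm_2 synth_def
    by (rule sum_coefficients_le[OF Lq_space_2(2)[OF f2] Lq_space_2(1)[OF f2] _ _ _ fin])
      (use measurable_synth[OF Q, of coef] integrable_synth[OF Q, of coef] in \<open>simp_all add: synth_def coefficient_def\<close>)
  then have "(energy Q)\<^sup>2 \<le> (Lq_norm 2 f * sqrt (LINT x|lebesgue. (norm (synth coef Q x))\<^sup>2))\<^sup>2"
    by (rule power_mono) (rule energy_nonneg)
  then show ?thesis
    by (simp add: power_mult_distrib)
qed

text \<open>Duality, the expansion of the square norm and the row estimate combined. The weighted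
  sum that remains is estimated in two different ways below.\<close>

lemma energy_core:
  assumes Q: "Q \<subseteq> \<Union>\<F>" and A: "A \<ge> 0"
    and size: "\<And>P. P \<in> Q \<Longrightarrow> norm (coef P) \<le> A * sqrt (width P)"
  shows "(energy Q)\<^sup>2 \<le> (Lq_norm 2 f)\<^sup>2 *
    (mass * energy Q + 2 * cross_const * (A * (\<Sum>P\<in>Q. norm (coef P) * (sqrt (width P) * weight (tree_of P) P))))"
proof -
  have "(\<Sum>P\<in>Q. norm (coef P) * (\<Sum>P'\<in>{P'\<in>Q. under P P'}. norm (coef P') * norm (gram P P'))) \<le>
     (\<Sum>P\<in>Q. norm (coef P) * (cross_const * A * (sqrt (width P) * weight (tree_of P) P)))"
    unfolding cross_const_def by (intro sum_mono mult_left_mono gram_sum_le[OF Q _ A size]) auto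
  also have "\<dots> = cross_const * (A * (\<Sum>P\<in>Q. norm (coef P) * (sqrt (width P) * weight (tree_of P) P)))"
    by (simp add: sum_distrib_left mult_ac)
  finally have "(LINT x|lebesgue. (norm (synth coef Q x))\<^sup>2) \<le>
     mass * energy Q + 2 * cross_const * (A * (\<Sum>P\<in>Q. norm (coef P) * (sqrt (width P) * weight (tree_of P) P)))"
    using integral_synth_le[OF Q, of coef] unfolding mass_def energy_def by linarith
  then show ?thesis
    using energy_sq_le[OF Q] by (meson mult_left_mono order_trans zero_le_power2)
qed

text \<open>Cancels one factor of the energy; if it vanishes, the claim is trivial.\<close>

lemma energy_le_of_sq:
  assumes "C \<le> level_const" "(energy Q)\<^sup>2 \<le> (Lq_norm 2 f)\<^sup>2 * (C * energy Q)"
  shows "energy Q \<le> level_const * (Lq_norm 2 f)\<^sup>2"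
proof (cases "energy Q = 0")
  case True
  then show ?thesis
    using const_nonneg by simp
next
  case False
  then have e: "energy Q > 0"
    using energy_nonneg[of Q] by simp
  then have "energy Q \<le> (Lq_norm 2 f)\<^sup>2 * C"
    using assms(2) by (simp add: power2_eq_square flip: mult.assoc)
  also have "\<dots> \<le> (Lq_norm 2 f)\<^sup>2 * level_const"
    using assms(1) by (intro mult_left_mono) auto
  finally show ?thesis
    by (simp add: mult.commute)
qed

text \<open>With the weight bounded by 1, the lower bound \<open>large\<close> replaces
  \<open>A * sqrt (width P)\<close> by twice the coefficient, so the off-diagonal part is itself a
  multiple of the energy.\<close>

lemma energy_comparable:
  assumes Q: "Q \<subseteq> \<Union>\<F>" and A: "A \<ge> 0"
    and size: "\<And>P. P \<in> Q \<Longrightarrow> norm (coef P) \<le> A * sqrt (width P)"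
    and large: "\<And>P. P \<in> Q \<Longrightarrow> A * sqrt (width P) \<le> 2 * norm (coef P)"
  shows "energy Q \<le> level_const * (Lq_norm 2 f)\<^sup>2"
proof (rule energy_le_of_sq)
  show "mass + 4 * cross_const \<le> level_const"
    using const_nonneg by (simp add: level_const_def)
  have "A * (\<Sum>P\<in>Q. norm (coef P) * (sqrt (width P) * weight (tree_of P) P)) =
      (\<Sum>P\<in>Q. norm (coef P) * (A * sqrt (width P) * weight (tree_of P) P))"
    by (simp add: sum_distrib_left mult_ac)
  also have "\<dots> \<le> (\<Sum>P\<in>Q. norm (coef P) * (2 * norm (coef P) * 1))"
    by (intro sum_mono mult_left_mono mult_mono large) (auto simp: weight_def)
  also have "\<dots> = 2 * energy Q"
    by (simp add: energy_def sum_distrib_left power2_eq_square mult_ac)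
  finally have "mass * energy Q + 2 * cross_const * (A * (\<Sum>P\<in>Q. norm (coef P) * (sqrt (width P) * weight (tree_of P) P)))
     \<le> mass * energy Q + 2 * cross_const * (2 * energy Q)"
    using const_nonneg by (intro add_left_mono mult_left_mono) auto
  also have "\<dots> = (mass + 4 * cross_const) * energy Q"
    by (simp add: algebra_simps)
  finally show "(energy Q)\<^sup>2 \<le> (Lq_norm 2 f)\<^sup>2 * ((mass + 4 * cross_const) * energy Q)"
    using energy_core[OF Q A size] by (meson mult_left_mono order_trans zero_le_power2)
qed

lemma top_length_nonneg: "top_length \<ge> 0"
  by (simp add: sum_nonneg)

text \<open>Here the decay of the weight is used: Cauchy-Schwarz splits off the weighted widths,
  whose sum is at most a multiple of \<open>top_length\<close>, and \<open>small\<close> converts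
  \<open>A * sqrt top_length\<close> into the norm of \<open>f\<close>.\<close>

lemma energy_small:
  assumes Q: "Q \<subseteq> \<Union>\<F>" and A: "A \<ge> 0"
    and size: "\<And>P. P \<in> Q \<Longrightarrow> norm (coef P) \<le> A * sqrt (width P)"
    and small: "A * sqrt top_length \<le> Lq_norm 2 f"
  shows "energy Q \<le> level_const * (Lq_norm 2 f)\<^sup>2"
proof (cases "energy Q \<le> (Lq_norm 2 f)\<^sup>2")
  case True
  have "energy Q \<le> (Lq_norm 2 f)\<^sup>2"
    by (rule True)
  also have "\<dots> \<le> level_const * (Lq_norm 2 f)\<^sup>2"
    using mult_right_mono[OF const_nonneg(4), of "(Lq_norm 2 f)\<^sup>2"] by simp
  finally show ?thesis .
next
  case False
  \<comment> \<open>Outside the trivial case the norm of \<open>f\<close> is at most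
    \<open>sqrt (energy Q)\<close>, which supplies the second root needed for a full factor of the
    energy.\<close>
  then have le: "Lq_norm 2 f \<le> sqrt (energy Q)"
    using real_le_rsqrt[of "Lq_norm 2 f" "energy Q"] by simp
  define X where "X = (\<Sum>P\<in>Q. norm (coef P) * (sqrt (width P) * weight (tree_of P) P))"
  have "X\<^sup>2 \<le> (\<Sum>P\<in>Q. (norm (coef P))\<^sup>2) * (\<Sum>P\<in>Q. (sqrt (width P) * weight (tree_of P) P)\<^sup>2)"
    unfolding X_def by (rule Cauchy_Schwarz_ineq_sum)
  also have "(\<Sum>P\<in>Q. (sqrt (width P) * weight (tree_of P) P)\<^sup>2) \<le> (\<Sum>P\<in>Q. width P * weight (tree_of P) P)"
  proof (rule sum_mono)
    fix P
    have "(weight (tree_of P) P)\<^sup>2 \<le> weight (tree_of P) P"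
      unfolding weight_def power2_eq_square by (rule mult_left_le) simp_all
    then show "(sqrt (width P) * weight (tree_of P) P)\<^sup>2 \<le> width P * weight (tree_of P) P"
      by (simp add: power_mult_distrib mult_left_mono)
  qed
  also have "\<dots> \<le> (\<Sum>P\<in>\<Union>\<F>. width P * weight (tree_of P) P)"
    by (rule sum_mono2[OF finite_union Q]) (simp add: weight_def)
  also note sum_weight_union_le
  finally have "X\<^sup>2 \<le> energy Q * (10 * pi * top_length)"
    by (simp add: energy_def sum_nonneg mult_left_mono)
  then have "X \<le> sqrt (energy Q) * (sqrt (10 * pi) * sqrt top_length)"
    using real_le_rsqrt[of X "energy Q * (10 * pi * top_length)"] by (simp add: real_sqrt_mult)
  then have "A * X \<le> A * (sqrt (energy Q) * (sqrt (10 * pi) * sqrt top_length))"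
    by (rule mult_left_mono) (rule A)
  also have "\<dots> = (A * sqrt top_length) * (sqrt (10 * pi) * sqrt (energy Q))"
    by (simp add: mult_ac)
  also have "\<dots> \<le> sqrt (energy Q) * (sqrt (10 * pi) * sqrt (energy Q))"
    using small le energy_nonneg by (intro mult_right_mono) auto
  also have "\<dots> = sqrt (10 * pi) * energy Q"
    using energy_nonneg[of Q] by simp
  finally have AX: "A * X \<le> sqrt (10 * pi) * energy Q" .
  show ?thesis
  proof (rule energy_le_of_sq)
    show "mass + 2 * cross_const * sqrt (10 * pi) \<le> level_const"
      using const_nonneg by (simp add: level_const_def)
    have "mass * energy Q + 2 * cross_const * (A * X) \<le> mass * energy Q + 2 * cross_const * (sqrt (10 * pi) * energy Q)"
      using const_nonneg by (intro add_left_mono mult_left_mono AX) auto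
    also have "\<dots> = (mass + 2 * cross_const * sqrt (10 * pi)) * energy Q"
      by (simp add: algebra_simps)
    finally show "(energy Q)\<^sup>2 \<le> (Lq_norm 2 f)\<^sup>2 * ((mass + 2 * cross_const * sqrt (10 * pi)) * energy Q)"
      using energy_core[OF Q A size] unfolding X_def[symmetric] by (meson mult_left_mono order_trans zero_le_power2)
  qed
qed

text \<open>Each step splits off the tiles whose coefficients are within a factor 2 of
  \<open>A * sqrt (width P)\<close>, at the cost of one \<open>level_const\<close>, and goes on with
  \<open>A / 2\<close>. After \<open>n\<close> halvings the small case applies, whence
  \<open>n + 1\<close>.\<close>

lemma energy_levels:
  assumes "Q \<subseteq> \<Union>\<F>" "A \<ge> 0" "\<And>P. P \<in> Q \<Longrightarrow> norm (coef P) \<le> A * sqrt (width P)"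
    and "A * sqrt top_length \<le> 2 ^ n * Lq_norm 2 f"
  shows "energy Q \<le> (real n + 1) * level_const * (Lq_norm 2 f)\<^sup>2"
  using assms
proof (induction n arbitrary: Q A)
  case 0
  then show ?case
    using energy_small[of Q A] by simp
next
  case (Suc n)
  define R where "R = {P \<in> Q. A * sqrt (width P) \<le> 2 * norm (coef P)}"
  have fin: "finite Q"
    using finite_subset[OF Suc.prems(1) finite_union] .
  have "energy R \<le> level_const * (Lq_norm 2 f)\<^sup>2"
    using Suc.prems by (intro energy_comparable[of R A]) (auto simp: R_def)
  moreover have "energy (Q - R) \<le> (real n + 1) * level_const * (Lq_norm 2 f)\<^sup>2"
    using Suc.prems by (intro Suc.IH[of "Q - R" "A / 2"]) (auto simp: R_def)
  moreover have "energy Q = energy R + energy (Q - R)"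
    unfolding energy_def using sum.subset_diff[of R Q "\<lambda>P. (norm (coef P))\<^sup>2"] fin by (simp add: R_def)
  ultimately show ?case
    by (simp add: algebra_simps)
qed

lemma energy_log:
  "energy (\<Union>\<F>) \<le> level_const * (3 + 2 * ln (max 1 L1_norm)) * (Lq_norm 2 f)\<^sup>2 *
     (1 + log_plus (Linf_norm f / Lq_norm 2 f * sqrt top_length))"
proof (cases "Lq_norm 2 f = 0")
  case True
  \<comment> \<open>With zero norm the quotient inside the logarithm is a division by zero, but
    duality forces the energy to vanish.\<close>
  then have "(energy (\<Union>\<F>))\<^sup>2 \<le> 0"
    using energy_sq_le[of "\<Union>\<F>"] by simp
  then show ?thesis
    using True by simp
next
  case False
  then have f0: "Lq_norm 2 f > 0"
    using L2_nonneg by simp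
  define ell where "ell = Linf_norm f / Lq_norm 2 f * sqrt top_length"
  define B where "B = max 1 L1_norm"
  have ell: "ell \<ge> 0"
    unfolding ell_def using Linf_norm_nonneg[OF finf] f0 top_length_nonneg by simp
  have B: "B \<ge> 1" "L1_norm \<le> B"
    by (simp_all add: B_def)
  \<comment> \<open>Both factors are at least 1, so the binary logarithm of \<open>x\<close> is
    nonnegative and can be rounded up to a number of halvings.\<close>
  define x where "x = B * max 1 ell"
  have x: "x \<ge> 1"
    unfolding x_def using B mult_mono[of 1 B 1 "max 1 ell"] by simp
  define n where "n = nat \<lceil>log 2 x\<rceil>"
  have l0: "log 2 x \<ge> 0"
    using x by simp
  have n: "log 2 x \<le> real n" "real n \<le> log 2 x + 1"
    unfolding n_def using l0 by linarith+
  have "x = 2 powr log 2 x"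
    using x by simp
  also have "\<dots> \<le> 2 powr real n"
    using n(1) by simp
  also have "\<dots> = 2 ^ n"
    by (simp add: powr_realpow)
  finally have xn: "x \<le> 2 ^ n" .
  have "L1_norm * Linf_norm f * sqrt top_length = L1_norm * ell * Lq_norm 2 f"
    using f0 by (simp add: ell_def)
  also have "\<dots> \<le> x * Lq_norm 2 f"
    unfolding x_def using B ell const_nonneg f0 by (intro mult_right_mono mult_mono) auto
  also have "\<dots> \<le> 2 ^ n * Lq_norm 2 f"
    using xn f0 by simp
  finally have "energy (\<Union>\<F>) \<le> (real n + 1) * level_const * (Lq_norm 2 f)\<^sup>2"
    using const_nonneg Linf_norm_nonneg[OF finf]
    by (intro energy_levels[of "\<Union>\<F>" "L1_norm * Linf_norm f" n] norm_coef_le) auto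
  moreover have "real n + 1 \<le> (3 + 2 * ln B) * (1 + log_plus ell)"
  proof -
    \<comment> \<open>From \<open>ln (1 / 2) \<le> - 1 / 2\<close>; it costs a factor 2 in passing
      from the binary to the natural logarithm.\<close>
    have ln2: "ln 2 \<ge> (1 / 2 :: real)"
      using ln_le_minus_one[of "1 / 2 :: real"] by (simp add: ln_div)
    have lnB: "ln B \<ge> 0"
      using B by simp
    have lm: "ln (max 1 ell) = log_plus ell"
    proof (cases "ell \<ge> 1")
      case True
      then show ?thesis by (simp add: log_plus_def max_def)
    next
      case False
      \<comment> \<open>This includes \<open>ell = 0\<close>, where \<open>ln\<close> takes a
        default value.\<close>
      then have "ln ell \<le> 0"
        using ell by (cases "ell = 0") auto
      then show ?thesis using False by (simp add: log_plus_def max_def)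
    qed
    have "ln x = ln B + log_plus ell"
      unfolding x_def lm[symmetric] using B by (intro ln_mult_pos) auto
    moreover have "log 2 x \<le> 2 * ln x"
    proof -
      have "ln x * 1 \<le> ln x * (2 * ln 2)"
        using x ln2 by (intro mult_left_mono) auto
      then show ?thesis
        by (simp add: log_def pos_divide_le_eq)
    qed
    ultimately have "real n + 1 \<le> 2 + 2 * ln B + 2 * log_plus ell"
      using n(2) by simp
    also have "\<dots> \<le> (3 + 2 * ln B) * (1 + log_plus ell)"
    proof -
      have "log_plus ell \<ge> 0"
        by (simp add: log_plus_def)
      then show ?thesis
        using lnB mult_nonneg_nonneg[of "ln B" "log_plus ell"] by (simp add: algebra_simps)
    qed
    finally show ?thesis .
  qed
  then have "(real n + 1) * (level_const * (Lq_norm 2 f)\<^sup>2) \<le> ((3 + 2 * ln B) * (1 + log_plus ell)) * (level_const * (Lq_norm 2 f)\<^sup>2)"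
    using const_nonneg by (intro mult_right_mono) auto
  ultimately show ?thesis
    unfolding ell_def[symmetric] B_def[symmetric] by (simp add: mult_ac)
qed

lemma tree_sums:
  "(\<Sum>\<T>\<in>\<F>. (Lq_norm 2 (tree_sum \<phi> f \<T>))\<^sup>2) = mass * energy (\<Union>\<F>)"
proof -
  have "(Lq_norm 2 (tree_sum \<phi> f \<T>))\<^sup>2 = mass * (\<Sum>P\<in>\<T>. (norm (coef P))\<^sup>2)" if "\<T> \<in> \<F>" for \<T>
  proof -
    have "tree_sum \<phi> f \<T> = synth coef \<T>"
      by (simp add: fun_eq_iff tree_sum_def synth_def)
    then show ?thesis
      using integral_synth_tree[OF that, of coef] by (simp add: Lq_norm_2_sq mass_def)
  qed
  then show ?thesis
    unfolding energy_def sum_trees by (simp add: sum_distrib_left)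
qed

end

text \<open>For \<open>l > 1\<close> the number \<open>x = l powr (1 - \<alpha>)\<close> is at least
  1, so \<open>(1 - \<alpha>) * ln l = ln x \<le> x \<le> x\<^sup>2\<close>. Dividing before taking
  the root leaves only \<open>1 / sqrt (1 - \<alpha>)\<close>.\<close>

lemma sqrt_log_plus_le:
  assumes l: "l \<ge> 0" and \<alpha>: "\<alpha> \<in> {0<..<1}"
  shows "sqrt (1 + log_plus l) \<le> 1 + l powr (1 - \<alpha>) / sqrt (1 - \<alpha>)"
proof (cases "l > 1")
  case True
  define x where "x = l powr (1 - \<alpha>)"
  have x: "x > 0" "x \<ge> 1"
    using True \<alpha> by (simp_all add: x_def ge_one_powr_ge_zero)
  have "(1 - \<alpha>) * ln l = ln x"
    using True by (simp add: x_def ln_powr)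
  also have "\<dots> \<le> x"
    using ln_le_minus_one[OF x(1)] by simp
  also have "\<dots> \<le> x\<^sup>2"
    using x(2) by (simp add: power2_eq_square)
  finally have "ln l \<le> (x / sqrt (1 - \<alpha>))\<^sup>2"
    using \<alpha> by (simp add: power_divide pos_le_divide_eq mult.commute)
  then have "sqrt (ln l) \<le> x / sqrt (1 - \<alpha>)"
    using real_sqrt_le_mono[of "ln l" "(x / sqrt (1 - \<alpha>))\<^sup>2"] x \<alpha> by simp
  moreover have eq: "log_plus l = ln l"
    using True by (simp add: log_plus_def)
  moreover have "sqrt (1 + ln l) \<le> 1 + sqrt (ln l)"
    using sqrt_add_le_add_sqrt[of 1 "ln l"] True by simp
  ultimately show ?thesis
    unfolding eq x_def[symmetric] by linarith
next
  case False
  then have "ln l \<le> 0"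
    using l by (cases "l = 0") auto
  then show ?thesis
    using \<alpha> by (simp add: log_plus_def)
qed

text \<open>Homogeneity: with \<open>l = m / n * s\<close>, the product
  \<open>n * l powr (1 - \<alpha>)\<close> equals
  \<open>(m * s) powr (1 - \<alpha>) * n powr \<alpha>\<close>.\<close>

lemma log_bound_le_power_bound:
  fixes C n m :: real
  assumes C: "C \<ge> 0" and n: "n \<ge> 0" and m: "m \<ge> 0" and \<alpha>: "\<alpha> \<in> {0<..<1}" and s: "s \<ge> 0"
  shows "C * n * sqrt (1 + log_plus (m / n * s)) \<le> C * n + C / sqrt (1 - \<alpha>) * (m * s) powr (1 - \<alpha>) * n powr \<alpha>"
proof (cases "n = 0")
  case True
  then show ?thesis by simp
next
  case False
  then have n0: "n > 0" using n by simp
  define l where "l = m / n * s"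
  have l: "l \<ge> 0"
    using m n0 s by (simp add: l_def)
  have "n * l powr (1 - \<alpha>) = (m * s) powr (1 - \<alpha>) * n powr \<alpha>"
  proof -
    have "m * s = l * n"
      using n0 by (simp add: l_def)
    then have "(m * s) powr (1 - \<alpha>) * n powr \<alpha> = l powr (1 - \<alpha>) * (n powr (1 - \<alpha>) * n powr \<alpha>)"
      using l n0 by (simp add: powr_mult)
    also have "n powr (1 - \<alpha>) * n powr \<alpha> = n"
      using n0 by (simp flip: powr_add)
    finally show ?thesis by simp
  qed
  moreover have "C * n * sqrt (1 + log_plus l) \<le> C * n * (1 + l powr (1 - \<alpha>) / sqrt (1 - \<alpha>))"
    using C n by (intro mult_left_mono sqrt_log_plus_le l \<alpha>) auto
  moreover have "C * n * (1 + l powr (1 - \<alpha>) / sqrt (1 - \<alpha>)) = C * n + C / sqrt (1 - \<alpha>) * (n * l powr (1 - \<alpha>))"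
    by (simp add: field_simps)
  ultimately show ?thesis
    unfolding l_def[symmetric] by (simp add: mult.assoc)
qed

theorem proposition6p6:
  fixes \<phi> :: "real \<Rightarrow> complex"
  assumes "wave_packet_profile \<phi>"
  shows "fourier_tile_type TYPE('h::complex_hilbert) \<phi> 2 \<and>
    (\<exists>C1>0. \<exists>C2>0. \<exists>C3>0. \<forall>t t' r. \<forall>f :: real \<Rightarrow> 'h. \<forall>\<F>.
       r > 0 \<longrightarrow> f \<in> Lq_space 2 \<inter> Linf_space \<longrightarrow> admissible_trees t t' r \<F> \<longrightarrow>
       sqrt (\<Sum>\<T>\<in>\<F>. (Lq_norm 2 (tree_sum \<phi> f \<T>))\<^sup>2)
         \<le> C1 * sqrt (\<Sum>P\<in>\<Union>\<F>. (norm (coefficient \<phi> f P))\<^sup>2) \<and>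
       C1 * sqrt (\<Sum>P\<in>\<Union>\<F>. (norm (coefficient \<phi> f P))\<^sup>2)
         \<le> C2 * Lq_norm 2 f *
             sqrt (1 + log_plus (Linf_norm f / Lq_norm 2 f *
                                 sqrt (\<Sum>\<T>\<in>\<F>. len (tree_interval t t' r \<T>)))) \<and>
       (\<forall>\<alpha>\<in>{0<..<1}.
          C2 * Lq_norm 2 f *
             sqrt (1 + log_plus (Linf_norm f / Lq_norm 2 f *
                                 sqrt (\<Sum>\<T>\<in>\<F>. len (tree_interval t t' r \<T>))))
          \<le> C3 * Lq_norm 2 f +
            C3 / sqrt (1 - \<alpha>) *
              (Linf_norm f * sqrt (\<Sum>\<T>\<in>\<F>. len (tree_interval t t' r \<T>))) powr (1 - \<alpha>) *
              Lq_norm 2 f powr \<alpha>))"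
proof -
  \<comment> \<open>\<open>K\<close> is obtained before the grids, the trees and the function are
    fixed, which makes \<open>C1\<close> and \<open>C2\<close> uniform.\<close>
  obtain K where K: "profile \<phi> K"
    using assms schwartz_decay[of \<phi>] unfolding wave_packet_profile_def profile_def by (metis assms)
  interpret pr: profile \<phi> K by (rule K)
  \<comment> \<open>The added 1 keeps the constant positive even if \<open>mass\<close>
    vanishes.\<close>
  define C1 where "C1 = sqrt pr.mass + 1"
  define D where "D = pr.level_const * (3 + 2 * ln (max 1 pr.L1_norm))"
  define C2 where "C2 = C1 * sqrt D"
  have C1: "C1 > 0"
    using pr.const_nonneg by (simp add: C1_def add_nonneg_pos)
  have D: "D > 0"
    unfolding D_def using pr.const_nonneg(4) by (intro mult_pos_pos add_pos_nonneg) auto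
  have C2: "C2 > 0"
    using C1 D by (simp add: C2_def)
  have main: "sqrt (\<Sum>\<T>\<in>\<F>. (Lq_norm 2 (tree_sum \<phi> f \<T>))\<^sup>2)
         \<le> C1 * sqrt (\<Sum>P\<in>\<Union>\<F>. (norm (coefficient \<phi> f P))\<^sup>2)" (is ?A)
    "C1 * sqrt (\<Sum>P\<in>\<Union>\<F>. (norm (coefficient \<phi> f P))\<^sup>2)
         \<le> C2 * Lq_norm 2 f * sqrt (1 + log_plus (Linf_norm f / Lq_norm 2 f *
                                 sqrt (\<Sum>\<T>\<in>\<F>. len (tree_interval t t' r \<T>))))" (is ?B)
    "\<forall>\<alpha>\<in>{0<..<1}. C2 * Lq_norm 2 f *
             sqrt (1 + log_plus (Linf_norm f / Lq_norm 2 f *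
                                 sqrt (\<Sum>\<T>\<in>\<F>. len (tree_interval t t' r \<T>))))
          \<le> C2 * Lq_norm 2 f +
            C2 / sqrt (1 - \<alpha>) *
              (Linf_norm f * sqrt (\<Sum>\<T>\<in>\<F>. len (tree_interval t t' r \<T>))) powr (1 - \<alpha>) *
              Lq_norm 2 f powr \<alpha>" (is ?C)
    if "r > 0" "f \<in> Lq_space 2 \<inter> Linf_space" "admissible_trees t t' r \<F>"
    for t t' r and f :: "real \<Rightarrow> 'h" and \<F>
  proof -
    interpret tile_setting t t' r \<F> \<phi> K f
      using that by unfold_locales auto
    have e: "(\<Sum>P\<in>\<Union>\<F>. (norm (coefficient \<phi> f P))\<^sup>2) = energy (\<Union>\<F>)"
      by (simp add: energy_def)
    show ?A
      unfolding e tree_sums real_sqrt_mult C1_def using energy_nonneg[of "\<Union>\<F>"]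
      by (intro mult_right_mono) auto
    have "sqrt (energy (\<Union>\<F>)) \<le> sqrt (D * (Lq_norm 2 f)\<^sup>2 * (1 + log_plus (Linf_norm f / Lq_norm 2 f * sqrt top_length)))"
      using energy_log unfolding D_def by simp
    also have "\<dots> = sqrt D * Lq_norm 2 f * sqrt (1 + log_plus (Linf_norm f / Lq_norm 2 f * sqrt top_length))"
      using L2_nonneg by (simp add: real_sqrt_mult)
    finally show ?B
      unfolding e C2_def using C1 by (simp add: mult.assoc)
    show ?C
      using C2 L2_nonneg Linf_norm_nonneg[OF finf] top_length_nonneg
      by (intro ballI log_bound_le_power_bound) auto
  qed
  have "fourier_tile_type_with TYPE('h) \<phi> 2 \<alpha>" if \<alpha>: "\<alpha> \<in> {0<..<1}" for \<alpha>
    unfolding fourier_tile_type_with_def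
  \<comment> \<open>Tile-type has one constant in front of both terms, and it may depend on
    \<alpha>. Since \<open>sqrt (1 - \<alpha>) \<le> 1\<close>, this witness also dominates
    \<open>C2\<close>.\<close>
  proof (intro exI[of _ "C2 / sqrt (1 - \<alpha>)"] allI impI)
    fix t t' r and f :: "real \<Rightarrow> 'h" and \<F>
    assume *: "r > 0" "f \<in> Lq_space 2 \<inter> Linf_space" "admissible_trees t t' r \<F>"
    define n m where "n = Lq_norm 2 f" and "m = (Linf_norm f * sqrt (\<Sum>\<T>\<in>\<F>. len (tree_interval t t' r \<T>))) powr (1 - \<alpha>) * n powr \<alpha>"
    have "n \<ge> 0"
      by (simp add: n_def Lq_norm_2)
    have "C2 \<le> C2 / sqrt (1 - \<alpha>)"
      using C2 \<alpha> by (simp add: pos_le_divide_eq mult_left_le)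
    then have "C2 * n \<le> C2 / sqrt (1 - \<alpha>) * n"
      using \<open>n \<ge> 0\<close> by (rule mult_right_mono)
    moreover have "sqrt (\<Sum>\<T>\<in>\<F>. (Lq_norm 2 (tree_sum \<phi> f \<T>))\<^sup>2) \<le> C2 * n + C2 / sqrt (1 - \<alpha>) * m"
      using main[OF *] \<alpha> unfolding n_def m_def by (force simp: mult.assoc)
    moreover have "(\<Sum>\<T>\<in>\<F>. Lq_norm 2 (tree_sum \<phi> f \<T>) powr 2) powr (1 / 2) = sqrt (\<Sum>\<T>\<in>\<F>. (Lq_norm 2 (tree_sum \<phi> f \<T>))\<^sup>2)"
      by (simp add: Lq_norm_2 powr_half_sqrt sum_nonneg)
    ultimately show "(\<Sum>\<T>\<in>\<F>. Lq_norm 2 (tree_sum \<phi> f \<T>) powr 2) powr (1 / 2) \<le>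
        C2 / sqrt (1 - \<alpha>) * Lq_norm 2 f +
        C2 / sqrt (1 - \<alpha>) * (Linf_norm f * (\<Sum>\<T>\<in>\<F>. len (tree_interval t t' r \<T>)) powr (1 / 2)) powr (1 - \<alpha>) *
          Lq_norm 2 f powr \<alpha>"
      unfolding n_def m_def by (simp add: powr_half_sqrt sum_nonneg mult.assoc)
  qed
  then have "fourier_tile_type TYPE('h) \<phi> 2"
    unfolding fourier_tile_type_def by blast
  \<comment> \<open>The witness for the third constant is again \<open>C2\<close>, as the last
    inequality loses no factor.\<close>
  show ?thesis
  proof (rule conjI, fact, rule exI[of _ C1], rule conjI[OF C1], rule exI[of _ C2], rule conjI[OF C2],
      rule exI[of _ C2], rule conjI[OF C2], intro allI impI conjI)
  qed (rule main; assumption)+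
qed

end
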